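(* In the setting of the context, suppose: (1) there exists a neural network architecture $\mathcal{F}^{\mathfrak s}$ with activation function $\sigma^{\mathfrak s}$ such that for every $w\in H^2(\Omega)$ and every $\epsilon>0$ there exist $\mathfrak d^{\mathfrak s},\mathfrak w^{\mathfrak s}\in\mathbb{N}$ and $u\in\mathcal{F}^{\mathfrak s}(\mathfrak d^{\mathfrak s},\mathfrak w^{\mathfrak s},\sigma^{\mathfrak s})$ with $\|u-w\|_V\le\epsilon$; (2) there exists a neural network architecture $\mathcal{F}^{\mathfrak t}$ with activation function $\sigma^{\mathfrak t}$ such that for every $\epsilon>0$ there exist $\mathfrak d^{\mathfrak t},\mathfrak w^{\mathfrak t}\in\mathbb{N}$ such that for every $k\in Y$ there is $v\in\mathcal{F}^{\mathfrak t}(\mathfrak d^{\mathfrak t},\mathfrak w^{\mathfrak t},\sigma^{\mathfrak t})$ with $\|v-k\|_V\le\epsilon$ (i.e. $\mathfrak d^{\mathfrak t},\mathfrak w^{\mathfrak t}$ are independent of $k$); (3) there exists $\bar R>0$ such that $\|v\|_V\le\bar R$ for all $v\in K\cap Y$. Fix $P\ge1+\|u^*\|_V$ and $Q\ge1+\bar R$. Then for any $\epsilon>0$ there exist architectures $\mathcal{F}^{\mathfrak s},\mathcal{F}^{\mathfrak t}$, activations $\sigma^{\mathfrak s},\sigma^{\mathfrak t}$ and numbers $\mathfrak d^{\mathfrak s},\mathfrak w^{\mathfrak s},\mathfrak d^{\mathfrak t},\mathfrak w^{\mathfrak t}\in\mathbb{N}$ such that, with $$\mathcal{X}^{\mathfrak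 s}=\mathcal{F}^{\mathfrak s}(\mathfrak d^{\mathfrak s},\mathfrak w^{\mathfrak s},\sigma^{\mathfrak s})\cap B^{H^1(\Omega)}(P),\qquad\mathcal{X}^{\mathfrak t}=\mathcal{F}^{\mathfrak t}(\mathfrak d^{\mathfrak t},\mathfrak w^{\mathfrak t},\sigma^{\mathfrak t})\cap B^{H^1(\Omega)}(Q),$$ one has $\xi_{\mathrm{app}}\le\epsilon$, where $$\begin{aligned}\xi_{\mathrm{app}}:={}&\sup_{v\in K\cap Y}\inf_{w\in\mathcal{X}^{\mathfrak t}}\big(K_1\|w-v\|_V+K_2\|w-v\|_{L^2(\Omega)}+K_3\|w-v\|_{L^2(\partial\Omega)}\big)\\&+\inf_{u\in\mathcal{X}^{\mathfrak s}}\big(K_4\|u-u^*\|_V+K_5\|u-u^*\|_{L^2(\Omega)}+K_6\|u-u^*\|_{L^2(\partial\Omega)}\big).\end{aligned}$$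
   Context: $\Omega\subset\mathbb{R}^n$ bounded Lipschitz domain, $V:=H^1(\Omega)$. Data: $f\in L^2(\Omega)$, $h\in H^{1/2}(\partial\Omega)$, $\psi\in H^1(\Omega)$, $\psi\le h$ on $\partial\Omega$ (traces), $K:=\{u\in H^1(\Omega):u\ge\psi\text{ in }\Omega,\ u=h\text{ on }\partial\Omega\}$. $A\colon V\to V^*$ is the linear operator $\langle Au,w\rangle=\int_\Omega\nabla u\cdot\nabla w+\sum_ib_i\partial_{x_i}u\,w+kuw$ with constants $b_i,k\ge0$, satisfying $\|Au-Av\|_{V^*}\le C_b\|u-v\|_V$ and $\langle Au-Av,u-v\rangle\ge C_a\|u-v\|_V^2$ with constants $C_a,C_b>0$. $u^*$ is the unique solution of: $u\in K$, $\langle Au-f,u-v\rangle\le0$ for all $v\in K$. $\gamma>\frac1{2C_a}$; weights $w_{b_i},w_{o_i}\ge0$ ($i=1,2$). The sets $X,Y$ satisfy: $u^*\in X\cap Y$; $K\cap X\subset K\cap Y$; $K\cap Y$ convex and closed in $V$. A neural network architecture $\mathcal{F}$ assigns to each depth $\mathfrak d\in\mathbb{N}$, width $\mathfrak w\in\mathbb{N}$ and activation $\sigma$ a set $\mathcal{F}(\mathfrak d,\mathfrak w,\sigma)\subset V$ of (restrictions to $\Omega$ of) neural networks. $B^{H^1(\Omega)}(\rho)$ is the closed ball of radius $\rho$ about $0$ in $H^1(\Omega)$. $C_T$ is the trace constant: $\|v\|_{L^2(\partial\Omega)}\le C_T\|v\|_V$. Constants: $R^*:=\max(P,Q,C_TP,C_TQ)$;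 $M^{\mathrm s},B^{\mathrm s},M^{\mathrm t},B^{\mathrm t}\in(0,R^*]$ are such that $\|u\|_V\le M^{\mathrm s}$, $\|u\|_{L^2(\partial\Omega)}\le B^{\mathrm s}$ on $\mathcal{X}^{\mathfrak s}$ and $\|v\|_V\le M^{\mathrm t}$, $\|v\|_{L^2(\partial\Omega)}\le B^{\mathrm t}$ on $\mathcal{X}^{\mathfrak t}$; $r>0$ is a fixed constant with $\|v\|_{L^2(\Omega)}\le r$ for $v\in K\cap Y$ (e.g. $r=\bar R$); $C_1=\|Au^*-f\|_{V^*}$; $K_1=C_bM^{\mathrm s}+\|f\|_{V^*}+\frac1\gamma(M^{\mathrm s}+M^{\mathrm t})$, $K_2=w_{o_2}(r+M^{\mathrm t}+2\|\psi\|_{L^2(\Omega)})$, $K_3=2w_{b_2}(\|h\|_{L^2(\partial\Omega)}+B^{\mathrm t})$, $K_4=C_b(M^{\mathrm s}+M^{\mathrm t})+C_1+\frac1\gamma(\|u^*\|_V+M^{\mathrm t})$, $K_5=w_{o_1}(M^{\mathrm s}+\|u^*\|_V+2\|\psi\|_{L^2(\Omega)})$, $K_6=2w_{b_1}(\|h\|_{L^2(\partial\Omega)}+B^{\mathrm s})$. *)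

theory Defs
  imports "HOL-Analysis.Analysis"
begin

text \<open>
  Elements of the function spaces below are represented by functions on the whole space, of which
  only the values on the domain matter; two functions that agree almost everywhere on the domain
  represent the same element. Norms are therefore seminorms on representatives, and uniqueness
  means uniqueness almost everywhere.
\<close>

section \<open>Domains\<close>

text \<open>Near every boundary point the domain is, in the direction of some unit vector \<open>e\<close>,
  the part of a ball lying above the graph of a Lipschitz function on the hyperplane orthogonal
  to \<open>e\<close>. The function \<open>g\<close> is only evaluated on that hyperplane.\<close>

definition lipschitz_boundary :: "(real^'n) set \<Rightarrow> bool" where
  "lipschitz_boundary \<Omega> \<longleftrightarrow>
     (\<forall>p\<in>frontier \<Omega>. \<exists>\<rho>>0. \<exists>e g L. norm e = 1 \<and> L-lipschitz_on {y. y \<bullet> e = 0} (g :: real^'n \<Rightarrow> real) \<and>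
        \<Omega> \<inter> ball p \<rho> = {x \<in> ball p \<rho>. g (x - (x \<bullet> e) *\<^sub>R e) < x \<bullet> e})"

definition bounded_lipschitz_domain :: "(real^'n) set \<Rightarrow> bool" where
  "bounded_lipschitz_domain \<Omega> \<longleftrightarrow>
     open \<Omega> \<and> connected \<Omega> \<and> \<Omega> \<noteq> {} \<and> bounded \<Omega> \<and> lipschitz_boundary \<Omega>"

section \<open>Smooth functions and weak gradients\<close>

primrec C_k :: "nat \<Rightarrow> (real^'n \<Rightarrow> real) \<Rightarrow> bool" where
  "C_k 0 \<phi> \<longleftrightarrow> continuous_on UNIV \<phi>"
| "C_k (Suc m) \<phi> \<longleftrightarrow>
     (\<exists>D :: real^'n \<Rightarrow> real^'n. (\<forall>x. GDERIV \<phi> x :> D x) \<and> (\<forall>i. C_k m (\<lambda>x. D x $ i)))"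

definition smooth :: "(real^'n \<Rightarrow> real) \<Rightarrow> bool" where
  "smooth \<phi> \<longleftrightarrow> (\<forall>m. C_k m \<phi>)"

definition test_function :: "(real^'n) set \<Rightarrow> (real^'n \<Rightarrow> real) \<Rightarrow> bool" where
  "test_function \<Omega> \<phi> \<longleftrightarrow>
     smooth \<phi> \<and> compact (closure {x. \<phi> x \<noteq> 0}) \<and> closure {x. \<phi> x \<noteq> 0} \<subseteq> \<Omega>"

definition L2_space :: "'a measure \<Rightarrow> ('a \<Rightarrow> 'b::euclidean_space) set" where
  "L2_space M = {u \<in> borel_measurable M. integrable M (\<lambda>x. (norm (u x))\<^sup>2)}"

definition L2_norm :: "'a measure \<Rightarrow> ('a \<Rightarrow> 'b::euclidean_space) \<Rightarrow> real" where
  "L2_norm M u = sqrt (LINT x|M. (norm (u x))\<^sup>2)"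

definition is_weak_gradient ::
    "(real^'n) set \<Rightarrow> (real^'n \<Rightarrow> real) \<Rightarrow> (real^'n \<Rightarrow> real^'n) \<Rightarrow> bool" where
  "is_weak_gradient \<Omega> u g \<longleftrightarrow>
     (\<forall>\<phi> D. test_function \<Omega> \<phi> \<longrightarrow> (\<forall>x. GDERIV \<phi> x :> D x) \<longrightarrow>
        (LINT x|lebesgue_on \<Omega>. u x *\<^sub>R D x) = - (LINT x|lebesgue_on \<Omega>. \<phi> x *\<^sub>R g x))"

section \<open>Sobolev spaces\<close>

definition H1 :: "(real^'n) set \<Rightarrow> (real^'n \<Rightarrow> real) set" where
  "H1 \<Omega> = {u \<in> L2_space (lebesgue_on \<Omega>). \<exists>g \<in> L2_space (lebesgue_on \<Omega>). is_weak_gradient \<Omega> u g}"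

text \<open>A representative of the weak gradient, which is unique up to null sets.\<close>

definition wgrad :: "(real^'n) set \<Rightarrow> (real^'n \<Rightarrow> real) \<Rightarrow> real^'n \<Rightarrow> real^'n" where
  "wgrad \<Omega> u = (SOME g. g \<in> L2_space (lebesgue_on \<Omega>) \<and> is_weak_gradient \<Omega> u g)"

definition H2 :: "(real^'n) set \<Rightarrow> (real^'n \<Rightarrow> real) set" where
  "H2 \<Omega> = {u \<in> H1 \<Omega>. \<forall>i. (\<lambda>x. wgrad \<Omega> u x $ i) \<in> H1 \<Omega>}"

definition dom_norm :: "(real^'n) set \<Rightarrow> (real^'n \<Rightarrow> real) \<Rightarrow> real" where
  "dom_norm \<Omega> u = L2_norm (lebesgue_on \<Omega>) u"

definition H1_norm :: "(real^'n) set \<Rightarrow> (real^'n \<Rightarrow> real) \<Rightarrow> real" where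
  "H1_norm \<Omega> u = sqrt ((dom_norm \<Omega> u)\<^sup>2 + (L2_norm (lebesgue_on \<Omega>) (wgrad \<Omega> u))\<^sup>2)"

definition H1_ball :: "(real^'n) set \<Rightarrow> real \<Rightarrow> (real^'n \<Rightarrow> real) set" where
  "H1_ball \<Omega> \<rho> = {u \<in> H1 \<Omega>. H1_norm \<Omega> u \<le> \<rho>}"

definition H1_closed :: "(real^'n) set \<Rightarrow> (real^'n \<Rightarrow> real) set \<Rightarrow> bool" where
  "H1_closed \<Omega> S \<longleftrightarrow>
     (\<forall>s u. (\<forall>j::nat. s j \<in> S) \<longrightarrow> u \<in> H1 \<Omega> \<longrightarrow> (\<lambda>j. H1_norm \<Omega> (s j - u)) \<longlonglongrightarrow> 0 \<longrightarrow> u \<in> S)"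

definition convex_fun_set :: "(real^'n \<Rightarrow> real) set \<Rightarrow> bool" where
  "convex_fun_set S \<longleftrightarrow>
     (\<forall>u\<in>S. \<forall>v\<in>S. \<forall>t\<in>{0..1}. (\<lambda>x. (1 - t) * u x + t * v x) \<in> S)"

section \<open>Surface measure and traces\<close>

text \<open>The Hausdorff measure of dimension \<open>n - 1\<close>, normalised by the volume of the unit ball of
  that dimension. The empty set is treated separately so that it contributes nothing to a cover
  even when \<open>n = 1\<close>, where the power below is \<open>0 ^ 0 = 1\<close>.\<close>

definition hausdorff_content :: "real \<Rightarrow> (real^'n) set \<Rightarrow> ennreal" where
  "hausdorff_content \<delta> A =
     (INF E \<in> {E :: nat \<Rightarrow> (real^'n) set.
                 A \<subseteq> (\<Union>j. E j) \<and> (\<forall>j. bounded (E j) \<and> diameter (E j) \<le> \<delta>)}.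
        (\<Sum>j. if E j = {} then 0
              else ennreal (unit_ball_vol (real (CARD('n) - 1)) *
                            (diameter (E j) / 2) ^ (CARD('n) - 1))))"

definition hausdorff_outer :: "(real^'n) set \<Rightarrow> ennreal" where
  "hausdorff_outer A = (SUP \<delta>\<in>{0<..}. hausdorff_content \<delta> A)"

definition surface_measure :: "(real^'n) set \<Rightarrow> (real^'n) measure" where
  "surface_measure \<Omega> =
     restrict_space (measure_of UNIV (sets borel) hausdorff_outer) (frontier \<Omega>)"

text \<open>The trace is the continuous extension to \<open>H1 \<Omega>\<close> of the restriction to the boundary of
  functions that are smooth up to the boundary; the following relation is its graph.\<close>

definition has_trace :: "(real^'n) set \<Rightarrow> (real^'n \<Rightarrow> real) \<Rightarrow> (real^'n \<Rightarrow> real) \<Rightarrow> bool" where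
  "has_trace \<Omega> u g \<longleftrightarrow> u \<in> H1 \<Omega> \<and> g \<in> L2_space (surface_measure \<Omega>) \<and>
     (\<exists>\<phi> :: nat \<Rightarrow> real^'n \<Rightarrow> real. (\<forall>j. smooth (\<phi> j)) \<and>
        (\<lambda>j. H1_norm \<Omega> (\<phi> j - u)) \<longlonglongrightarrow> 0 \<and>
        (\<lambda>j. L2_norm (surface_measure \<Omega>) (\<phi> j - g)) \<longlonglongrightarrow> 0)"

definition bdry_trace :: "(real^'n) set \<Rightarrow> (real^'n \<Rightarrow> real) \<Rightarrow> real^'n \<Rightarrow> real" where
  "bdry_trace \<Omega> u = (SOME g. has_trace \<Omega> u g)"

definition bdry_norm :: "(real^'n) set \<Rightarrow> (real^'n \<Rightarrow> real) \<Rightarrow> real" where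
  "bdry_norm \<Omega> u = L2_norm (surface_measure \<Omega>) (bdry_trace \<Omega> u)"

text \<open>The Sobolev-Slobodeckij space of order one half; the exponent is \<open>(n - 1) + 2 * (1/2) = n\<close>.\<close>

definition H_half :: "(real^'n) set \<Rightarrow> (real^'n \<Rightarrow> real) set" where
  "H_half \<Omega> = {g \<in> L2_space (surface_measure \<Omega>).
     (\<integral>\<^sup>+x. (\<integral>\<^sup>+y. ennreal ((g x - g y)\<^sup>2 / norm (x - y) ^ CARD('n))
        \<partial>surface_measure \<Omega>) \<partial>surface_measure \<Omega>) < \<infinity>}"

section \<open>The variational inequality\<close>

text \<open>Functionals in the dual of \<open>H1 \<Omega>\<close> are maps on functions.\<close>

definition dual_norm :: "(real^'n) set \<Rightarrow> ((real^'n \<Rightarrow> real) \<Rightarrow> real) \<Rightarrow> real" where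
  "dual_norm \<Omega> F = (SUP w\<in>H1_ball \<Omega> 1. \<bar>F w\<bar>)"

definition L2_functional :: "(real^'n) set \<Rightarrow> (real^'n \<Rightarrow> real) \<Rightarrow> (real^'n \<Rightarrow> real) \<Rightarrow> real" where
  "L2_functional \<Omega> f w = (LINT x|lebesgue_on \<Omega>. f x * w x)"

definition operator_A :: "(real^'n) set \<Rightarrow> real^'n \<Rightarrow> real \<Rightarrow>
    (real^'n \<Rightarrow> real) \<Rightarrow> (real^'n \<Rightarrow> real) \<Rightarrow> real" where
  "operator_A \<Omega> b k u w =
     (LINT x|lebesgue_on \<Omega>. wgrad \<Omega> u x \<bullet> wgrad \<Omega> w x
        + (\<Sum>i\<in>UNIV. b $ i * (wgrad \<Omega> u x $ i) * w x) + k * u x * w x)"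

definition obstacle_set ::
    "(real^'n) set \<Rightarrow> (real^'n \<Rightarrow> real) \<Rightarrow> (real^'n \<Rightarrow> real) \<Rightarrow> (real^'n \<Rightarrow> real) set" where
  "obstacle_set \<Omega> \<psi> h =
     {u \<in> H1 \<Omega>. (AE x in lebesgue_on \<Omega>. \<psi> x \<le> u x) \<and> has_trace \<Omega> u h}"

definition solves_VI :: "(real^'n) set \<Rightarrow> real^'n \<Rightarrow> real \<Rightarrow> (real^'n \<Rightarrow> real) \<Rightarrow>
    (real^'n \<Rightarrow> real) set \<Rightarrow> (real^'n \<Rightarrow> real) \<Rightarrow> bool" where
  "solves_VI \<Omega> b k f K u \<longleftrightarrow>
     u \<in> K \<and> (\<forall>v\<in>K. (operator_A \<Omega> b k u - L2_functional \<Omega> f) (u - v) \<le> 0)"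

definition unique_solution_VI :: "(real^'n) set \<Rightarrow> real^'n \<Rightarrow> real \<Rightarrow> (real^'n \<Rightarrow> real) \<Rightarrow>
    (real^'n \<Rightarrow> real) set \<Rightarrow> (real^'n \<Rightarrow> real) \<Rightarrow> bool" where
  "unique_solution_VI \<Omega> b k f K u \<longleftrightarrow> solves_VI \<Omega> b k f K u \<and>
     (\<forall>u'. solves_VI \<Omega> b k f K u' \<longrightarrow> (AE x in lebesgue_on \<Omega>. u' x = u x))"

section \<open>Neural network architectures\<close>

text \<open>Feedforward networks with \<open>d\<close> hidden layers of at most \<open>w\<close> neurons (unused neurons have
  zero weights). Here \<open>a l j\<close> is the output of neuron \<open>j\<close> in layer \<open>l\<close>. Weights from all earlier
  layers are admitted, so that architectures with skip connections are included; ordinary fully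
  connected networks are those in which all but the weights between consecutive layers vanish.\<close>

definition neural_networks :: "nat \<Rightarrow> nat \<Rightarrow> (real \<Rightarrow> real) \<Rightarrow> (real^'n \<Rightarrow> real) set" where
  "neural_networks d w \<sigma> = {N. \<exists>(a :: nat \<Rightarrow> nat \<Rightarrow> real^'n \<Rightarrow> real)
       (W :: nat \<Rightarrow> nat \<Rightarrow> nat \<Rightarrow> nat \<Rightarrow> real) (\<alpha> :: nat \<Rightarrow> nat \<Rightarrow> real^'n) (\<beta> :: nat \<Rightarrow> nat \<Rightarrow> real)
       (c :: nat \<Rightarrow> nat \<Rightarrow> real) \<alpha>\<^sub>0 \<beta>\<^sub>0.
     (\<forall>l<d. \<forall>j<w. \<forall>x. a l j x = \<sigma> (\<beta> l j + \<alpha> l j \<bullet> x + (\<Sum>m<l. \<Sum>i<w. W l j m i * a m i x))) \<and>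
     (\<forall>x. N x = \<beta>\<^sub>0 + \<alpha>\<^sub>0 \<bullet> x + (\<Sum>m<d. \<Sum>i<w. c m i * a m i x))}"

text \<open>An architecture selects, for each depth, width and activation, a set of such networks
  (e.g. by prescribing the connectivity or bounds on the weights) belonging to \<open>H1 \<Omega>\<close>.\<close>

type_synonym 'n arch = "nat \<Rightarrow> nat \<Rightarrow> (real \<Rightarrow> real) \<Rightarrow> (real^'n \<Rightarrow> real) set"

definition architecture :: "(real^'n) set \<Rightarrow> 'n arch \<Rightarrow> bool" where
  "architecture \<Omega> F \<longleftrightarrow> (\<forall>d w \<sigma>. F d w \<sigma> \<subseteq> neural_networks d w \<sigma> \<inter> H1 \<Omega>)"

definition approximates_H2 :: "(real^'n) set \<Rightarrow> 'n arch \<Rightarrow> (real \<Rightarrow> real) \<Rightarrow> bool" where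
  "approximates_H2 \<Omega> F \<sigma> \<longleftrightarrow> architecture \<Omega> F \<and>
     (\<forall>g\<in>H2 \<Omega>. \<forall>\<epsilon>>0. \<exists>d w. \<exists>u \<in> F d w \<sigma>. H1_norm \<Omega> (u - g) \<le> \<epsilon>)"

definition approximates_uniformly ::
    "(real^'n) set \<Rightarrow> (real^'n \<Rightarrow> real) set \<Rightarrow> 'n arch \<Rightarrow> (real \<Rightarrow> real) \<Rightarrow> bool" where
  "approximates_uniformly \<Omega> Y F \<sigma> \<longleftrightarrow> architecture \<Omega> F \<and>
     (\<forall>\<epsilon>>0. \<exists>d w. \<forall>y\<in>Y. \<exists>v \<in> F d w \<sigma>. H1_norm \<Omega> (v - y) \<le> \<epsilon>)"

section \<open>The approximation error\<close>

definition weighted_norm :: "(real^'n) set \<Rightarrow> real \<Rightarrow> real \<Rightarrow> real \<Rightarrow> (real^'n \<Rightarrow> real) \<Rightarrow> real" where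
  "weighted_norm \<Omega> c\<^sub>1 c\<^sub>2 c\<^sub>3 z = c\<^sub>1 * H1_norm \<Omega> z + c\<^sub>2 * dom_norm \<Omega> z + c\<^sub>3 * bdry_norm \<Omega> z"

text \<open>The extended reals avoid junk values of suprema and infima over unbounded or empty sets.\<close>

definition xi_app :: "(real^'n) set \<Rightarrow> (real^'n \<Rightarrow> real) set \<Rightarrow> (real^'n \<Rightarrow> real) \<Rightarrow>
    (real^'n \<Rightarrow> real) set \<Rightarrow> (real^'n \<Rightarrow> real) set \<Rightarrow>
    real \<Rightarrow> real \<Rightarrow> real \<Rightarrow> real \<Rightarrow> real \<Rightarrow> real \<Rightarrow> ereal" where
  "xi_app \<Omega> S u\<^sub>0 Xs Xt K\<^sub>1 K\<^sub>2 K\<^sub>3 K\<^sub>4 K\<^sub>5 K\<^sub>6 =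
     (SUP v\<in>S. INF w\<in>Xt. ereal (weighted_norm \<Omega> K\<^sub>1 K\<^sub>2 K\<^sub>3 (w - v))) +
     (INF u\<in>Xs. ereal (weighted_norm \<Omega> K\<^sub>4 K\<^sub>5 K\<^sub>6 (u - u\<^sub>0)))"

end

theory Submission
  imports Defs
begin

text \<open>
  All weights \<open>K\<^sub>i\<close> are bounded in terms of \<open>R\<^sup>*\<close> alone, hence independently of the networks, and the
  trace inequality bounds the weighted norms by a multiple of the \<open>H\<^sup>1\<close> norm. So it is enough to
  approximate \<open>K \<inter> Y\<close> uniformly and \<open>u\<^sup>*\<close> to a small tolerance in \<open>H\<^sup>1\<close>; a tolerance of at most \<open>1\<close> keeps
  the networks in the balls of radius \<open>Q\<close> and \<open>P\<close>. The uniform approximation is hypothesis (2).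
  Hypothesis (1) only covers \<open>H\<^sup>2\<close>, but \<open>u\<^sup>*\<close> has a trace and is therefore an \<open>H\<^sup>1\<close> limit of smooth
  functions, which lie in \<open>H\<^sup>2\<close>. The triangle inequality for the \<open>H\<^sup>1\<close> norm rests on the uniqueness of
  weak gradients, because \<open>wgrad\<close> is an arbitrary choice.
\<close>

section \<open>Smooth functions\<close>

text \<open>Uniqueness of weak gradients is the fundamental lemma of the calculus of variations. It
  is reached here without mollifiers: products of functions exp(-1/t) of the coordinates vanish
  outside a box, and rescaling the argument makes them tend to the indicator of the box while
  staying bounded by 1. Dominated convergence then turns vanishing test integrals into vanishing box
  integrals, and a pi-lambda argument turns these into vanishing almost everywhere. That smooth
  functions lie in H2 needs integration by parts. There is no boundary term, since a test function
  has compact support in the domain; what remains is that the gradient of a compactly supported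
  smooth function integrates to zero. The dual norms in the weights are real suprema about whose
  sign and finiteness nothing is proved. The estimates therefore use their absolute values: it is
  enough that they are numbers fixed before the networks are chosen.\<close>

lemma C_k_Suc_D: "C_k (Suc m) \<phi> \<Longrightarrow> C_k m \<phi>"
proof (induction m arbitrary: \<phi>)
  case 0
  then obtain D where "\<And>x. GDERIV \<phi> x :> D x" by auto
  then have "\<And>x. isCont \<phi> x"
    unfolding gderiv_def by (blast intro: has_derivative_continuous)
  then show ?case by (simp add: continuous_at_imp_continuous_on)
next
  case (Suc m)
  then obtain D where D: "\<And>x. GDERIV \<phi> x :> D x" "\<And>i. C_k (Suc m) (\<lambda>x. D x $ i)"
    unfolding C_k.simps(2)[of "Suc m"] by blast
  with Suc.IH have "\<And>i. C_k m (\<lambda>x. D x $ i)" by blast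
  with D(1) show ?case by auto
qed

lemma C_k_const: "C_k m (\<lambda>x::real^'n. c)"
proof (induction m arbitrary: c)
  case (Suc m)
  have "GDERIV (\<lambda>x. c) x :> (0 :: real^'n)" for x by (rule GDERIV_const)
  moreover have "C_k m (\<lambda>x::real^'n. (0 :: real^'n) $ i)" for i by (rule Suc)
  ultimately show ?case unfolding C_k.simps by (intro exI[of _ "\<lambda>x. 0"]) blast
qed simp

lemma C_k_add: "C_k m \<phi> \<Longrightarrow> C_k m \<psi> \<Longrightarrow> C_k m (\<lambda>x. \<phi> x + \<psi> x)"
proof (induction m arbitrary: \<phi> \<psi>)
  case (Suc m)
  then obtain D E where D: "\<And>x. GDERIV \<phi> x :> D x" "\<And>i. C_k m (\<lambda>x. D x $ i)"
    and E: "\<And>x. GDERIV \<psi> x :> E x" "\<And>i. C_k m (\<lambda>x. E x $ i)"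
    unfolding C_k.simps by blast
  have "GDERIV (\<lambda>x. \<phi> x + \<psi> x) x :> D x + E x" for x
    using D(1) E(1) by (rule GDERIV_add)
  moreover have "C_k m (\<lambda>x. (D x + E x) $ i)" for i
    unfolding vector_add_component using D(2) E(2) by (rule Suc.IH)
  ultimately show ?case unfolding C_k.simps by (intro exI[of _ "\<lambda>x. D x + E x"]) blast
qed (simp add: continuous_on_add)

lemma C_k_mult: "C_k m \<phi> \<Longrightarrow> C_k m \<psi> \<Longrightarrow> C_k m (\<lambda>x. \<phi> x * \<psi> x)"
proof (induction m arbitrary: \<phi> \<psi>)
  case (Suc m)
  then obtain D E where D: "\<And>x. GDERIV \<phi> x :> D x" "\<And>i. C_k m (\<lambda>x. D x $ i)"
    and E: "\<And>x. GDERIV \<psi> x :> E x" "\<And>i. C_k m (\<lambda>x. E x $ i)"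
    unfolding C_k.simps by blast
  have "GDERIV (\<lambda>x. \<phi> x * \<psi> x) x :> \<phi> x *\<^sub>R E x + \<psi> x *\<^sub>R D x" for x
    using D(1) E(1) by (rule GDERIV_mult)
  \<comment> \<open>The product rule leaves the factors \<open>\<phi>\<close> and
    \<open>\<psi>\<close> undifferentiated; \<open>C_k_Suc_D\<close> lowers them to order m so that
    the induction hypothesis applies to both products.\<close>
  moreover have "C_k m (\<lambda>x. (\<phi> x *\<^sub>R E x + \<psi> x *\<^sub>R D x) $ i)" for i
    unfolding vector_add_component vector_scaleR_component real_scaleR_def
    using Suc.prems[THEN C_k_Suc_D] D(2) E(2) by (intro C_k_add Suc.IH)
  ultimately show ?case
    unfolding C_k.simps by (intro exI[of _ "\<lambda>x. \<phi> x *\<^sub>R E x + \<psi> x *\<^sub>R D x"]) blast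
qed (simp add: continuous_on_mult)

lemma C_k_prod: "finite I \<Longrightarrow> (\<And>i. i \<in> I \<Longrightarrow> C_k m (\<phi> i)) \<Longrightarrow> C_k m (\<lambda>x. \<Prod>i\<in>I. \<phi> i x)"
  by (induction I rule: finite_induct) (simp_all add: C_k_const C_k_mult)

lemma smooth_mult: "smooth \<phi> \<Longrightarrow> smooth \<psi> \<Longrightarrow> smooth (\<lambda>x. \<phi> x * \<psi> x)"
  by (simp add: smooth_def C_k_mult)

lemma smooth_continuous_on:
  assumes "smooth \<phi>"
  shows "continuous_on S \<phi>"
proof -
  have "C_k 0 \<phi>" using assms by (simp only: smooth_def)
  then show ?thesis by (auto intro: continuous_on_subset)
qed

section \<open>Uniqueness and smoothness of classical gradients\<close>

lemma GDERIV_unique: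
  assumes "GDERIV \<phi> x :> d" "GDERIV \<phi> x :> e"
  shows "d = e"
proof -
  have "(\<lambda>y. y \<bullet> d) = (\<lambda>y. y \<bullet> e)"
    using assms unfolding gderiv_def by (rule has_derivative_unique)
  then show ?thesis by (simp add: fun_eq_iff vector_eq_ldot)
qed

text \<open>\<open>C_k\<close> provides a gradient for each order separately. Uniqueness of
  derivatives identifies all of them, so that one field \<open>D\<close> has components of every
  order.\<close>

lemma smooth_has_gradient:
  assumes "smooth \<phi>"
  obtains D where "\<And>x. GDERIV \<phi> x :> D x" "\<And>i. smooth (\<lambda>x. D x $ i)"
proof -
  have "C_k (Suc 0) \<phi>" using assms by (simp only: smooth_def)
  then obtain D where D: "\<And>x. GDERIV \<phi> x :> D x" by auto
  have "C_k m (\<lambda>x. D x $ i)" for m i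
  proof -
    have "C_k (Suc m) \<phi>" using assms by (simp only: smooth_def)
    then obtain E where "\<And>x. GDERIV \<phi> x :> E x" "\<And>i. C_k m (\<lambda>x. E x $ i)" by auto
    moreover from this D have "E = D" by (intro ext GDERIV_unique)
    ultimately show ?thesis by blast
  qed
  then have "\<And>i. smooth (\<lambda>x. D x $ i)" unfolding smooth_def by blast
  with D show thesis by (rule that)
qed

lemma smooth_gradient_continuous:
  assumes "smooth \<phi>" "\<And>x. GDERIV \<phi> x :> D x"
  shows "continuous_on S D"
proof -
  obtain E where E: "\<And>x. GDERIV \<phi> x :> E x" "\<And>i. smooth (\<lambda>x. E x $ i)"
    using smooth_has_gradient[OF assms(1)] by blast
  from E(1) assms(2) have "E = D" by (intro ext GDERIV_unique)
  then have "\<And>i. continuous_on S (\<lambda>x. D x $ i)"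
    using E(2) smooth_continuous_on by blast
  then have "continuous_on S (\<lambda>x. \<chi> i. D x $ i)" by (rule continuous_on_vec_lambda)
  then show ?thesis by simp
qed

subsection \<open>Bump functions\<close>

text \<open>For k = 0 this is the classical flat function exp(-1/t). The powers of 1/t make the
  family closed under differentiation up to linear combinations, so a single induction yields
  smoothness.\<close>

definition exp_bump :: "nat \<Rightarrow> real \<Rightarrow> real" where
  "exp_bump k t = (if t > 0 then exp (- inverse t) * inverse t ^ k else 0)"

text \<open>From the right, s = 1/t turns the claim into s^k / exp s tending to 0 at infinity; from
  the left the function is constantly 0.\<close>

lemma exp_bump_tendsto_0: "(exp_bump k \<longlongrightarrow> 0) (at 0)"
proof -
  have "((\<lambda>t. inverse t ^ k / exp (inverse t)) \<longlongrightarrow> (0::real)) (at_right 0)"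
    by (rule filterlim_compose[OF tendsto_power_div_exp_0 filterlim_inverse_at_top_right])
  moreover have "\<forall>\<^sub>F t in at_right 0. inverse t ^ k / exp (inverse t) = exp_bump k t"
    unfolding eventually_at_filter
    by (auto simp: exp_bump_def exp_minus divide_inverse)
  ultimately have "(exp_bump k \<longlongrightarrow> 0) (at_right 0)"
    by (rule Lim_transform_eventually)
  moreover have "(exp_bump k \<longlongrightarrow> 0) (at_left 0)"
    by (rule tendsto_eventually) (auto simp: eventually_at_filter exp_bump_def)
  ultimately show ?thesis by (simp add: filterlim_split_at)
qed

lemma exp_bump_DERIV:
  "(exp_bump k has_real_derivative exp_bump (k + 2) t - real k * exp_bump (k + 1) t) (at t)"
proof -
  consider "t > 0" | "t < 0" | "t = 0" by linarith
  then show ?thesis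
  proof cases
    case 1
    have "((\<lambda>t. exp (- inverse t) * inverse t ^ k) has_real_derivative
        exp_bump (k + 2) t - real k * exp_bump (k + 1) t) (at t)"
    proof -
      \<comment> \<open>The power rule produces the exponent k - 1, which is truncated for k = 0;
        there the factor \<open>real k\<close> vanishes.\<close>
      have "inverse t ^ (k - 1) * (inverse t * inverse t) * real k = real k * inverse t ^ (k + 1)"
        by (cases k) auto
      with 1 show ?thesis
        by (auto intro!: derivative_eq_intros simp: exp_bump_def algebra_simps)
    qed
    moreover have "\<forall>\<^sub>F s in nhds t. exp_bump k s = exp (- inverse s) * inverse s ^ k"
      using eventually_nhds_in_open[of "{0<..}" t] 1
      by (auto elim!: eventually_mono simp: exp_bump_def)
    ultimately show ?thesis by (simp only: DERIV_cong_ev[OF refl _ refl])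
  next
    case 2
    have "\<forall>\<^sub>F s in nhds t. exp_bump k s = 0"
      using eventually_nhds_in_open[of "{..<0}" t] 2
      by (auto elim!: eventually_mono simp: exp_bump_def)
    then have "(exp_bump k has_real_derivative 0) (at t) = ((\<lambda>_. 0) has_real_derivative 0) (at t)"
      by (intro DERIV_cong_ev) auto
    with 2 show ?thesis by (simp add: exp_bump_def)
  next
    case 3
    \<comment> \<open>The difference quotient at 0 is again a member of the family, so its limit is
      already known. At y = 0 both sides are 0, by division by zero on the left.\<close>
    have "(\<lambda>y. (exp_bump k y - exp_bump k 0) / (y - 0)) = exp_bump (Suc k)"
      by (auto simp: exp_bump_def divide_inverse)
    with 3 show ?thesis
      using exp_bump_tendsto_0[of "Suc k"] by (simp add: has_field_derivative_iff exp_bump_def)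
  qed
qed

text \<open>The exponent k is generalised in the induction because differentiation raises it to k +
  1 and k + 2. Affine functions of one coordinate suffice, as the bumps on boxes are products over
  the coordinates.\<close>

lemma C_k_exp_bump: "C_k m (\<lambda>x::real^'n. exp_bump k (c * x $ i + d))"
proof (induction m arbitrary: k)
  case 0
  have "continuous_on UNIV (exp_bump k)"
    using exp_bump_DERIV by (blast intro: DERIV_isCont continuous_at_imp_continuous_on)
  then have "continuous_on UNIV (\<lambda>x::real^'n. exp_bump k (c * x $ i + d))"
    by (rule continuous_on_compose2) (auto intro!: continuous_intros)
  then show ?case by simp
next
  case (Suc m)
  let ?e = "\<lambda>x::real^'n. exp_bump (k + 2) (c * x $ i + d) + - real k * exp_bump (k + 1) (c * x $ i + d)"
  have "((\<lambda>x::real^'n. c * x $ i + d) has_derivative (\<lambda>h. h \<bullet> (c *\<^sub>R axis i 1))) (at x)" for x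
    by (auto intro!: derivative_eq_intros bounded_linear_imp_has_derivative[OF bounded_linear_vec_nth]
        simp: inner_axis)
  then have "GDERIV (\<lambda>x::real^'n. c * x $ i + d) x :> c *\<^sub>R axis i 1" for x
    by (simp only: gderiv_def)
  from GDERIV_DERIV_compose[OF this exp_bump_DERIV]
  have "GDERIV (\<lambda>x::real^'n. exp_bump k (c * x $ i + d)) x :> ?e x *\<^sub>R c *\<^sub>R axis i 1" for x
    by simp
  moreover have "C_k m (\<lambda>x. ?e x * (c * axis i 1 $ j))" for j
    by (intro C_k_mult C_k_add C_k_const Suc.IH)
  then have "C_k m (\<lambda>x. (?e x *\<^sub>R c *\<^sub>R axis i 1) $ j)" for j
    by (simp only: vector_scaleR_component real_scaleR_def)
  ultimately show ?case
    unfolding C_k.simps by (intro exI[of _ "\<lambda>x. ?e x *\<^sub>R c *\<^sub>R axis i 1"] conjI allI)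
qed

text \<open>The factor \<open>real (Suc m)\<close> inside the bump does not move its zero set, so
  every function vanishes outside the same box; but exp(-1/((m+1)s)) tends to 1 for each s > 0,
  which gives the indicator of the open box in the limit.\<close>

lemma box_test_functions:
  fixes a b :: "real^'n"
  assumes "cbox a b \<subseteq> \<Omega>"
  obtains \<phi> :: "nat \<Rightarrow> real^'n \<Rightarrow> real" where
    "\<And>m. test_function \<Omega> (\<phi> m)" "\<And>m x. \<bar>\<phi> m x\<bar> \<le> 1"
    "\<And>x. (\<lambda>m. \<phi> m x) \<longlonglongrightarrow> indicator (box a b) x"
proof -
  \<comment> \<open>The arguments have the affine form required by \<open>C_k_exp_bump\<close>; the
    fact \<open>\<phi>\<close> below restores the factored form, from which signs can be read
    off.\<close>
  define \<phi> where "\<phi> m x = (\<Prod>i\<in>UNIV. exp_bump 0 (real (Suc m) * x $ i + - (real (Suc m) * a $ i)) *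
      exp_bump 0 (- real (Suc m) * x $ i + real (Suc m) * b $ i))" for m and x :: "real^'n"
  have pos: "exp_bump 0 (real (Suc m) * (s - t)) = (if t < s then exp (- inverse (real (Suc m) * (s - t))) else 0)"
    for s t m by (auto simp: exp_bump_def zero_less_mult_iff)
  have \<phi>: "\<phi> m x = (\<Prod>i\<in>UNIV. exp_bump 0 (real (Suc m) * (x $ i - a $ i)) *
      exp_bump 0 (real (Suc m) * (b $ i - x $ i)))" for m x
    by (simp add: \<phi>_def algebra_simps)
  have le1: "\<bar>exp_bump 0 t\<bar> \<le> 1" for t by (simp add: exp_bump_def)
  have supp: "x \<in> box a b" if nz: "\<phi> m x \<noteq> 0" for m x
  proof -
    have "a $ i < x $ i \<and> x $ i < b $ i" for i
    proof -
      have "exp_bump 0 (real (Suc m) * (x $ i - a $ i)) * exp_bump 0 (real (Suc m) * (b $ i - x $ i)) \<noteq> 0"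
        using nz unfolding \<phi> by simp
      then show ?thesis unfolding pos by (auto split: if_splits)
    qed
    then show ?thesis unfolding mem_box_cart by (rule allI)
  qed
  have "closure {x. \<phi> m x \<noteq> 0} \<subseteq> cbox a b" for m
  proof (rule closure_minimal[OF _ closed_cbox], rule subsetI)
    fix x assume "x \<in> {x. \<phi> m x \<noteq> 0}"
    then have "x \<in> box a b" using supp by simp
    then show "x \<in> cbox a b" using box_subset_cbox by (rule rev_subsetD)
  qed
  moreover from this have "compact (closure {x. \<phi> m x \<noteq> 0})" for m
    unfolding compact_eq_bounded_closed by (blast intro: bounded_subset[OF bounded_cbox])
  moreover have "smooth (\<phi> m)" for m
    unfolding smooth_def \<phi>_def by (intro allI C_k_prod C_k_mult C_k_exp_bump finite)
  ultimately have "test_function \<Omega> (\<phi> m)" for m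
    unfolding test_function_def using assms by blast
  moreover have "\<bar>\<phi> m x\<bar> \<le> 1" for m x
    unfolding \<phi> abs_prod by (rule prod_le_1) (use le1 in \<open>auto simp: abs_mult intro!: mult_le_one\<close>)
  moreover have "(\<lambda>m. \<phi> m x) \<longlonglongrightarrow> indicator (box a b) x" for x
  proof (cases "x \<in> box a b")
    case True
    have lim: "(\<lambda>m. exp_bump 0 (real (Suc m) * (s - t))) \<longlonglongrightarrow> 1" if "t < s" for s t
    proof -
      have "(\<lambda>m. exp (- (inverse (s - t) * inverse (real (Suc m))))) \<longlonglongrightarrow> exp (- (inverse (s - t) * 0))"
        by (intro tendsto_intros LIMSEQ_inverse_real_of_nat)
      then show ?thesis using that unfolding pos by (simp add: mult.commute)
    qed
    have "(\<lambda>m. \<phi> m x) \<longlonglongrightarrow> (\<Prod>i\<in>(UNIV::'n set). 1 * 1)"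
      unfolding \<phi> by (intro tendsto_prod tendsto_mult lim) (use True in \<open>auto simp: mem_box_cart\<close>)
    with True show ?thesis by simp
  next
    case False
    then have "\<phi> m x = 0" for m using supp by blast
    with False show ?thesis by simp
  qed
  ultimately show thesis by (rule that)
qed

section \<open>Square integrable functions\<close>

lemma L2_space_D:
  assumes "u \<in> L2_space M"
  shows "u \<in> borel_measurable M" "integrable M (\<lambda>x. (norm (u x))\<^sup>2)"
  using assms by (auto simp: L2_space_def)

lemma L2_norm_nonneg: "0 \<le> L2_norm M u"
  by (simp add: L2_norm_def)

lemma L2_norm_power2: "(L2_norm M u)\<^sup>2 = (LINT x|M. (norm (u x))\<^sup>2)"
  by (simp add: L2_norm_def)

lemma L2_space_lincomb:
  assumes "u \<in> L2_space M" "v \<in> L2_space M"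
  shows "(\<lambda>x. u x + c *\<^sub>R v x) \<in> L2_space M"
proof -
  note u = L2_space_D[OF assms(1)] and v = L2_space_D[OF assms(2)]
  have "(norm (a + c *\<^sub>R b))\<^sup>2 \<le> 2 * (norm a)\<^sup>2 + 2 * c\<^sup>2 * (norm b)\<^sup>2" for a b :: 'b
  proof -
    have "(norm (a + c *\<^sub>R b))\<^sup>2 \<le> (norm a + norm (c *\<^sub>R b))\<^sup>2"
      by (rule power_mono[OF norm_triangle_ineq norm_ge_zero])
    also have "\<dots> \<le> 2 * (norm a)\<^sup>2 + 2 * (norm (c *\<^sub>R b))\<^sup>2"
      using sum_squares_bound[of "norm a" "norm (c *\<^sub>R b)"] by (simp add: power2_sum)
    finally show ?thesis by (simp add: power_mult_distrib)
  qed
  then have bd: "norm ((norm (u x + c *\<^sub>R v x))\<^sup>2) \<le>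
      norm (2 * (norm (u x))\<^sup>2 + 2 * c\<^sup>2 * (norm (v x))\<^sup>2)" for x
    by simp
  have meas: "(\<lambda>x. u x + c *\<^sub>R v x) \<in> borel_measurable M"
    using u(1) v(1) by simp
  have "integrable M (\<lambda>x. (norm (u x + c *\<^sub>R v x))\<^sup>2)"
  proof (rule Bochner_Integration.integrable_bound)
    show "integrable M (\<lambda>x. 2 * (norm (u x))\<^sup>2 + 2 * c\<^sup>2 * (norm (v x))\<^sup>2)"
      using u(2) v(2) by simp
  qed (use meas bd in simp_all)
  with meas show ?thesis by (simp add: L2_space_def)
qed

lemma L2_inner_integrable:
  assumes "u \<in> L2_space M" "v \<in> L2_space M"
  shows "integrable M (\<lambda>x. u x \<bullet> v x)"
proof -
  note u = L2_space_D[OF assms(1)] and v = L2_space_D[OF assms(2)]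
  have "\<bar>a \<bullet> b\<bar> \<le> (norm a)\<^sup>2 + (norm b)\<^sup>2" for a b :: 'b
  proof -
    have "\<bar>a \<bullet> b\<bar> \<le> norm a * norm b" by (rule Cauchy_Schwarz_ineq2)
    moreover have "2 * norm a * norm b \<le> (norm a)\<^sup>2 + (norm b)\<^sup>2" by (rule sum_squares_bound)
    moreover have "0 \<le> norm a * norm b" by simp
    ultimately show ?thesis by linarith
  qed
  then have bd: "norm (u x \<bullet> v x) \<le> norm ((norm (u x))\<^sup>2 + (norm (v x))\<^sup>2)" for x
    by simp
  show ?thesis
  proof (rule Bochner_Integration.integrable_bound)
    show "integrable M (\<lambda>x. (norm (u x))\<^sup>2 + (norm (v x))\<^sup>2)" using u(2) v(2) by simp
    show "(\<lambda>x. u x \<bullet> v x) \<in> borel_measurable M" using u(1) v(1) by simp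
  qed (use bd in simp)
qed

lemma L2_norm_lincomb_power2:
  assumes "u \<in> L2_space M" "v \<in> L2_space M"
  shows "(L2_norm M (\<lambda>x. u x + c *\<^sub>R v x))\<^sup>2 =
    (L2_norm M u)\<^sup>2 + 2 * c * (LINT x|M. u x \<bullet> v x) + c\<^sup>2 * (L2_norm M v)\<^sup>2"
proof -
  have "(norm (u x + c *\<^sub>R v x))\<^sup>2 = (norm (u x))\<^sup>2 + 2 * c * (u x \<bullet> v x) + c\<^sup>2 * (norm (v x))\<^sup>2" for x
    unfolding power2_norm_eq_inner by (simp add: inner_add inner_commute algebra_simps power2_eq_square)
  then show ?thesis
    using L2_space_D[OF assms(1)] L2_space_D[OF assms(2)] L2_inner_integrable[OF assms]
    by (simp add: L2_norm_power2)
qed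

text \<open>The squared norm of u + c v is a nonnegative quadratic in c. The case of a vanishing
  norm of v is separate because the norm is only a seminorm on representatives.\<close>

lemma L2_Cauchy_Schwarz:
  assumes "u \<in> L2_space M" "v \<in> L2_space M"
  shows "(LINT x|M. u x \<bullet> v x) \<le> L2_norm M u * L2_norm M v"
proof -
  define a b C where "a = L2_norm M u" and "b = L2_norm M v" and "C = (LINT x|M. u x \<bullet> v x)"
  have pos: "a \<ge> 0" "b \<ge> 0" by (simp_all add: a_def b_def L2_norm_nonneg)
  have quad: "0 \<le> a\<^sup>2 + 2 * c * C + c\<^sup>2 * b\<^sup>2" for c
    using L2_norm_lincomb_power2[OF assms, of c] zero_le_power2 unfolding a_def b_def C_def by metis
  have "C \<le> a * b"
  proof (cases "b = 0")
    case True
    show ?thesis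
    proof (rule ccontr)
      assume "\<not> ?thesis"
      then have "C > 0" using True by simp
      \<comment> \<open>For b = 0 the quadratic is linear in c, and this c gives it the value
        -1.\<close>
      then show False using quad[of "- (a\<^sup>2 + 1) / (2 * C)"] True by (simp add: field_simps)
    qed
  next
    case False
    then have b: "b > 0" using pos by simp
    \<comment> \<open>The value -C / b^2 minimises the quadratic; multiplying by b^2 clears the
      denominators.\<close>
    have "0 \<le> b\<^sup>2 * (a\<^sup>2 + 2 * (- C / b\<^sup>2) * C + (- C / b\<^sup>2)\<^sup>2 * b\<^sup>2)"
      using quad[of "- C / b\<^sup>2"] by simp
    also have "\<dots> = (a * b)\<^sup>2 - C\<^sup>2"
      using b by (simp add: field_simps power2_eq_square)
    finally have "C\<^sup>2 \<le> (a * b)\<^sup>2" by (simp only: diff_ge_0_iff_ge)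
    then show ?thesis by (rule power2_le_imp_le) (use pos in simp)
  qed
  then show ?thesis by (simp add: a_def b_def C_def)
qed

lemma L2_norm_triangle:
  assumes "u \<in> L2_space M" "v \<in> L2_space M"
  shows "L2_norm M (\<lambda>x. u x + v x) \<le> L2_norm M u + L2_norm M v"
proof (rule power2_le_imp_le)
  show "(L2_norm M (\<lambda>x. u x + v x))\<^sup>2 \<le> (L2_norm M u + L2_norm M v)\<^sup>2"
    using L2_norm_lincomb_power2[OF assms, of 1] L2_Cauchy_Schwarz[OF assms]
    by (simp add: power2_sum)
qed (simp add: L2_norm_nonneg)

lemma L2_norm_cong_AE:
  assumes "u \<in> borel_measurable M" "v \<in> borel_measurable M" "AE x in M. u x = v x"
  shows "L2_norm M u = L2_norm M v"
proof -
  have "(LINT x|M. (norm (u x))\<^sup>2) = (LINT x|M. (norm (v x))\<^sup>2)"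
    by (rule integral_cong_AE) (use assms in auto)
  then show ?thesis by (simp add: L2_norm_def)
qed

text \<open>Since t <= 1 + t^2, square integrability on a finite measure space implies
  integrability. On a bounded domain this makes the integrals against test functions genuine ones
  instead of the default value 0.\<close>

lemma L2_space_integrable:
  assumes "finite_measure M" "u \<in> L2_space M"
  shows "integrable M u"
proof -
  interpret finite_measure M by fact
  have "norm y \<le> 1 + (norm y)\<^sup>2" for y :: 'b
    using sum_squares_bound[of 1 "norm y"] norm_ge_zero[of y] by (simp del: norm_ge_zero)
  then have bd: "norm (u x) \<le> norm (1 + (norm (u x))\<^sup>2)" for x by simp
  show ?thesis
  proof (rule Bochner_Integration.integrable_bound)
    show "integrable M (\<lambda>x. 1 + (norm (u x))\<^sup>2)" using L2_space_D(2)[OF assms(2)] by simp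
  qed (use bd L2_space_D(1)[OF assms(2)] in simp_all)
qed

section \<open>Integrability of products with a bounded factor\<close>

lemma integrable_bounded_scaleR_left:
  fixes u :: "'a \<Rightarrow> 'b::{banach, second_countable_topology}"
  assumes "integrable M u" "\<phi> \<in> borel_measurable M" "\<And>x. \<bar>\<phi> x\<bar> \<le> B"
  shows "integrable M (\<lambda>x. \<phi> x *\<^sub>R u x)"
proof (rule Bochner_Integration.integrable_bound[of M "\<lambda>x. B * norm (u x)"])
  have "\<bar>\<phi> x\<bar> * norm (u x) \<le> \<bar>B * norm (u x)\<bar>" for x
    using mult_right_mono[OF assms(3)[of x] norm_ge_zero[of "u x"]] by linarith
  then show "AE x in M. norm (\<phi> x *\<^sub>R u x) \<le> norm (B * norm (u x))" by simp
qed (use assms in simp_all)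

lemma integrable_bounded_scaleR_right:
  fixes D :: "'a \<Rightarrow> 'b::{banach, second_countable_topology}"
  assumes "integrable M u" "D \<in> borel_measurable M" "\<And>x. norm (D x) \<le> B"
  shows "integrable M (\<lambda>x. u x *\<^sub>R D x)"
proof (rule Bochner_Integration.integrable_bound[of M "\<lambda>x. B * u x"])
  have "\<bar>u x\<bar> * norm (D x) \<le> \<bar>B * u x\<bar>" for x
  proof -
    have "\<bar>u x\<bar> * norm (D x) \<le> \<bar>u x\<bar> * \<bar>B\<bar>"
      using assms(3)[of x] by (intro mult_left_mono) auto
    then show ?thesis by (simp add: abs_mult mult.commute)
  qed
  then show "AE x in M. norm (u x *\<^sub>R D x) \<le> norm (B * u x)" by simp
qed (use assms in simp_all)

section \<open>Test functions\<close>

lemma finite_measure_lebesgue_on_bounded: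
  assumes "bounded \<Omega>" "open \<Omega>"
  shows "finite_measure (lebesgue_on \<Omega>)"
  using lmeasurable_open[OF assms] by (simp add: finite_measure_lebesgue_on)

lemma borel_measurable_lebesgue_on:
  "f \<in> borel_measurable borel \<Longrightarrow> f \<in> borel_measurable (lebesgue_on S)"
  by (intro measurable_restrict_space1 measurable_completion) simp

lemma borel_measurable_continuous_lebesgue_on:
  "continuous_on UNIV f \<Longrightarrow> f \<in> borel_measurable (lebesgue_on S)"
  by (intro borel_measurable_lebesgue_on borel_measurable_continuous_onI)

lemma continuous_compact_support_bounded:
  fixes f :: "'a::topological_space \<Rightarrow> 'b::real_normed_vector"
  assumes "continuous_on UNIV f" "compact S" "\<And>x. x \<notin> S \<Longrightarrow> f x = 0"
  obtains B where "\<And>x. norm (f x) \<le> B"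
proof -
  have "bounded (f ` S)"
    using assms(1,2) by (intro compact_imp_bounded compact_continuous_image continuous_on_subset[OF assms(1)]) auto
  then obtain B where "B > 0" "\<And>x. x \<in> S \<Longrightarrow> norm (f x) \<le> B"
    unfolding bounded_pos by auto
  with assms(3) have "norm (f x) \<le> B" for x by (cases "x \<in> S") auto
  then show thesis by (rule that)
qed

section \<open>Support, bounds and integrability of test functions and their gradients\<close>

lemma GDERIV_zero_outside_support:
  assumes "GDERIV \<phi> x :> d" "x \<notin> closure {x. \<phi> x \<noteq> 0}"
  shows "d = 0"
proof -
  have "((\<lambda>_. 0) has_derivative (\<lambda>_. 0)) (at x)" by simp
  then have "(\<phi> has_derivative (\<lambda>_. 0)) (at x)"
  proof (rule has_derivative_transform_within_open)
    show "open (- closure {x. \<phi> x \<noteq> 0})" by (rule open_Compl[OF closed_closure])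
    show "x \<in> - closure {x. \<phi> x \<noteq> 0}" using assms(2) by simp
    show "0 = \<phi> y" if "y \<in> - closure {x. \<phi> x \<noteq> 0}" for y
      using that closure_subset[of "{x. \<phi> x \<noteq> 0}"] by auto
  qed
  then have "GDERIV \<phi> x :> 0" by (simp add: gderiv_def)
  with assms(1) show ?thesis by (rule GDERIV_unique)
qed

lemma test_function_zero_outside:
  assumes "test_function \<Omega> \<phi>" "x \<notin> \<Omega>"
  shows "\<phi> x = 0"
  using assms closure_subset[of "{x. \<phi> x \<noteq> 0}"] unfolding test_function_def by blast

lemma test_function_bounds:
  assumes "test_function \<Omega> \<phi>" "\<And>x. GDERIV \<phi> x :> D x"
  obtains B where "\<And>x. \<bar>\<phi> x\<bar> \<le> B" "\<And>x. norm (D x) \<le> B"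
proof -
  let ?S = "closure {x. \<phi> x \<noteq> 0}"
  have \<phi>: "smooth \<phi>" "compact ?S" using assms(1) by (simp_all add: test_function_def)
  have z: "\<phi> x = 0" if "x \<notin> ?S" for x
    using that closure_subset[of "{x. \<phi> x \<noteq> 0}"] by auto
  obtain B1 where B1: "\<And>x. norm (\<phi> x) \<le> B1"
    using continuous_compact_support_bounded[OF smooth_continuous_on[OF \<phi>(1)] \<phi>(2) z] by blast
  obtain B2 where B2: "\<And>x. norm (D x) \<le> B2"
    using continuous_compact_support_bounded[OF smooth_gradient_continuous[OF \<phi>(1) assms(2)] \<phi>(2)
        GDERIV_zero_outside_support[OF assms(2)]] by blast
  show thesis
  proof (rule that)
    show "\<bar>\<phi> x\<bar> \<le> max B1 B2" for x using B1[of x] by simp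
    show "norm (D x) \<le> max B1 B2" for x using B2[of x] by simp
  qed
qed

lemma test_function_integrable:
  assumes "test_function \<Omega> \<phi>" "\<And>x. GDERIV \<phi> x :> D x"
    and "integrable (lebesgue_on \<Omega>) u" "integrable (lebesgue_on \<Omega>) (g :: real^'n \<Rightarrow> real^'n)"
  shows "integrable (lebesgue_on \<Omega>) (\<lambda>x. u x *\<^sub>R D x)"
    and "integrable (lebesgue_on \<Omega>) (\<lambda>x. \<phi> x *\<^sub>R g x)"
proof -
  obtain B where B: "\<And>x. \<bar>\<phi> x\<bar> \<le> B" "\<And>x. norm (D x) \<le> B"
    using test_function_bounds[OF assms(1,2)] by blast
  have \<phi>: "smooth \<phi>" using assms(1) by (simp add: test_function_def)
  show "integrable (lebesgue_on \<Omega>) (\<lambda>x. u x *\<^sub>R D x)"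
    by (rule integrable_bounded_scaleR_right[OF assms(3) _ B(2)])
      (rule borel_measurable_continuous_lebesgue_on[OF smooth_gradient_continuous[OF \<phi> assms(2)]])
  show "integrable (lebesgue_on \<Omega>) (\<lambda>x. \<phi> x *\<^sub>R g x)"
    by (rule integrable_bounded_scaleR_left[OF assms(4) _ B(1)])
      (rule borel_measurable_continuous_lebesgue_on[OF smooth_continuous_on[OF \<phi>]])
qed

text \<open>Splitting a Bochner integral requires integrable summands. They are integrable because
  the domain has finite measure and test functions and their gradients are bounded.\<close>

lemma is_weak_gradient_lincomb:
  assumes "bounded \<Omega>" "open \<Omega>"
    and u: "u \<in> L2_space (lebesgue_on \<Omega>)" "g \<in> L2_space (lebesgue_on \<Omega>)" "is_weak_gradient \<Omega> u g"
    and v: "v \<in> L2_space (lebesgue_on \<Omega>)" "h \<in> L2_space (lebesgue_on \<Omega>)" "is_weak_gradient \<Omega> v h"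
  shows "is_weak_gradient \<Omega> (\<lambda>x. u x + c * v x) (\<lambda>x. g x + c *\<^sub>R h x)"
  unfolding is_weak_gradient_def
proof (intro allI impI)
  fix \<phi> D assume \<phi>: "test_function \<Omega> \<phi>" "\<forall>x. GDERIV \<phi> x :> D x"
  note fin = finite_measure_lebesgue_on_bounded[OF assms(1,2)]
  note iu = test_function_integrable[OF \<phi>(1) \<phi>(2)[rule_format] L2_space_integrable[OF fin u(1)]
      L2_space_integrable[OF fin u(2)]]
  note iv = test_function_integrable[OF \<phi>(1) \<phi>(2)[rule_format] L2_space_integrable[OF fin v(1)]
      L2_space_integrable[OF fin v(2)]]
  have eu: "(LINT x|lebesgue_on \<Omega>. u x *\<^sub>R D x) = - (LINT x|lebesgue_on \<Omega>. \<phi> x *\<^sub>R g x)"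
    using u(3) \<phi> unfolding is_weak_gradient_def by blast
  have ev: "(LINT x|lebesgue_on \<Omega>. v x *\<^sub>R D x) = - (LINT x|lebesgue_on \<Omega>. \<phi> x *\<^sub>R h x)"
    using v(3) \<phi> unfolding is_weak_gradient_def by blast
  have "(LINT x|lebesgue_on \<Omega>. (u x + c * v x) *\<^sub>R D x) =
      (LINT x|lebesgue_on \<Omega>. u x *\<^sub>R D x + c *\<^sub>R v x *\<^sub>R D x)"
    by (simp add: scaleR_add_left)
  also have "\<dots> = (LINT x|lebesgue_on \<Omega>. u x *\<^sub>R D x) + c *\<^sub>R (LINT x|lebesgue_on \<Omega>. v x *\<^sub>R D x)"
    by (subst Bochner_Integration.integral_add) (use iu(1) iv(1) in \<open>auto simp del: scaleR_scaleR\<close>)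
  also have "\<dots> = - (LINT x|lebesgue_on \<Omega>. \<phi> x *\<^sub>R g x) + c *\<^sub>R - (LINT x|lebesgue_on \<Omega>. \<phi> x *\<^sub>R h x)"
    by (simp only: eu ev)
  also have "\<dots> = - (LINT x|lebesgue_on \<Omega>. \<phi> x *\<^sub>R g x + c *\<^sub>R \<phi> x *\<^sub>R h x)"
    by (subst Bochner_Integration.integral_add) (use iu(2) iv(2) in \<open>auto simp del: scaleR_scaleR\<close>)
  also have "\<dots> = - (LINT x|lebesgue_on \<Omega>. \<phi> x *\<^sub>R (g x + c *\<^sub>R h x))"
    by (simp add: scaleR_add_right mult.commute)
  finally show "(LINT x|lebesgue_on \<Omega>. (u x + c * v x) *\<^sub>R D x) =
      - (LINT x|lebesgue_on \<Omega>. \<phi> x *\<^sub>R (g x + c *\<^sub>R h x))" .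
qed

section \<open>Uniqueness of weak gradients\<close>

text \<open>Pi-lambda argument: open boxes are stable under intersection and generate the Borel
  sets, and countable additivity covers disjoint unions. The whole space is not a box, so
  complements rely on \<open>total\<close>.\<close>

lemma integral_zero_on_borel_sets:
  fixes h :: "'a::euclidean_space \<Rightarrow> real"
  assumes h: "integrable lborel h"
    and total: "integral\<^sup>L lborel h = 0"
    and box: "\<And>c d. (LINT x:box c d|lborel. h x) = 0"
    and A: "A \<in> sets borel"
  shows "(LINT x:A|lborel. h x) = 0"
proof -
  let ?G = "range (\<lambda>(a, b). box a b :: 'a set)"
  have sets: "sets borel = sigma_sets UNIV ?G"
    by (subst borel_eq_box) (rule sets_measure_of, simp)
  have stable: "Int_stable ?G"
    unfolding Int_stable_def by (auto simp: box_Int_box)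
  have si: "set_integrable lborel B h" if "B \<in> sets borel" for B
    using integrable_mult_indicator[OF _ h, of B] that by (simp add: set_integrable_def)
  have "A \<in> sigma_sets UNIV ?G" using A sets by simp
  from stable subset_UNIV[of ?G, folded Pow_UNIV] this show ?thesis
  proof (induction rule: sigma_sets_induct_disjoint)
    case (basic A)
    then show ?case using box by auto
  next
    case empty
    show ?case by (simp add: set_lebesgue_integral_def)
  next
    case (compl A)
    then have "A \<in> sets borel" using sets by simp
    have "(LINT x:UNIV - A|lborel. h x) = (LINT x|lborel. h x - indicator A x *\<^sub>R h x)"
      unfolding set_lebesgue_integral_def
      by (rule Bochner_Integration.integral_cong) (auto simp: indicator_def)
    also have "\<dots> = integral\<^sup>L lborel h - (LINT x:A|lborel. h x)"
      unfolding set_lebesgue_integral_def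
      using si[OF \<open>A \<in> sets borel\<close>] h unfolding set_integrable_def
      by (rule Bochner_Integration.integral_diff[rotated])
    finally show ?case using compl.IH total by simp
  next
    case (union A)
    then have "\<And>i. A i \<in> sets lborel" using sets by auto
    moreover have "A i \<inter> A j = {}" if "i \<noteq> j" for i j
      using union(1) that by (simp add: disjoint_family_on_def)
    ultimately have "(LINT x:(\<Union>i. A i)|lborel. h x) = (\<Sum>i. (LINT x:A i|lborel. h x))"
      by (intro lebesgue_integral_countable_add si) auto
    then show ?case using union by simp
  qed
qed

lemma AE_zero_if_integral_zero_on_borel_sets:
  fixes h :: "'a::euclidean_space \<Rightarrow> real"
  assumes h: "integrable lborel h"
    and zero: "\<And>A. A \<in> sets borel \<Longrightarrow> (LINT x:A|lborel. h x) = 0"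
  shows "AE x in lborel. h x = 0"
proof -
  have meas: "h \<in> borel_measurable borel" using borel_measurable_integrable[OF h] by simp
  \<comment> \<open>The number \<open>s\<close> is the sign, 1 or -1, that makes h nonnegative on A;
    a nonnegative function with zero integral vanishes almost everywhere.\<close>
  have *: "AE x in lborel. indicator A x * h x = 0"
    if A: "A \<in> sets borel" and nn: "\<And>x. 0 \<le> s * (indicator A x * h x)" and s: "s \<noteq> 0" for A and s :: real
  proof -
    have i: "integrable lborel (\<lambda>x. s * (indicator A x * h x))"
      using integrable_mult_indicator[OF _ h, of A] A by simp
    have "integral\<^sup>L lborel (\<lambda>x. s * (indicator A x * h x)) = 0"
      using zero[OF A] by (simp add: set_lebesgue_integral_def)
    then have "AE x in lborel. s * (indicator A x * h x) = 0"
      using integral_nonneg_eq_0_iff_AE[OF i] nn by simp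
    with s show ?thesis by simp
  qed
  have "{x. h x > 0} \<in> sets borel" "{x. h x < 0} \<in> sets borel"
    using meas by measurable
  from *[OF this(1), of 1] *[OF this(2), of "- 1"]
  have "AE x in lborel. indicator {x. h x > 0} x * h x = 0" "AE x in lborel. indicator {x. h x < 0} x * h x = 0"
    by (simp_all add: indicator_def)
  then show ?thesis by eventually_elim (auto simp: indicator_def split: if_splits)
qed

text \<open>Only boxes with closure in the domain are controlled, so the Borel set argument runs
  inside one such box at a time, where the box itself supplies the vanishing total integral. By
  Lindelof, countably many of these boxes cover the domain, which keeps the union of the exceptional
  null sets null.\<close>

lemma AE_zero_if_box_integrals_zero:
  fixes g :: "'a::euclidean_space \<Rightarrow> real"
  assumes "open \<Omega>" and g: "integrable (lebesgue_on \<Omega>) g"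
    and box: "\<And>a b. cbox a b \<subseteq> \<Omega> \<Longrightarrow> (LINT x|lebesgue_on \<Omega>. indicator (box a b) x * g x) = 0"
  shows "AE x in lebesgue_on \<Omega>. g x = 0"
proof -
  have \<Omega>: "\<Omega> \<inter> space lebesgue \<in> sets lebesgue" using \<open>open \<Omega>\<close> by simp
  define f where "f x = indicator \<Omega> x *\<^sub>R g x" for x
  have f: "integrable lebesgue f" using g unfolding f_def by (simp only: integrable_restrict_space[OF \<Omega>])
  \<comment> \<open>The pi-lambda argument lives on Borel sets, so the Lebesgue measurable extension
    by zero is replaced by a Borel function equal to it almost everywhere.\<close>
  then obtain f' where f': "f' \<in> borel_measurable lborel" "AE x in lborel. f x = f' x"
    using completion_ex_borel_measurable_real[of f lborel] by (auto dest: borel_measurable_integrable)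
  have f'_leb: "f' \<in> borel_measurable lebesgue" using f'(1) by (rule measurable_completion)
  have AE: "AE x in lebesgue. f x = f' x" using f'(2) by (rule AE_completion)
  have "integrable lebesgue f'"
    using integrable_cong_AE_imp[OF f f'_leb] AE by (simp add: eq_commute)
  then have int: "integrable lborel f'" using integrable_completion[OF f'(1)] by simp
  have boxf': "(LINT x|lborel. indicator (box a b) x * f' x) = 0" if "cbox a b \<subseteq> \<Omega>" for a b
  proof -
    have ind: "(\<lambda>x. indicator (box a b) x :: real) \<in> borel_measurable lborel" by simp
    have "(LINT x|lborel. indicator (box a b) x * f' x) = (LINT x|lebesgue. indicator (box a b) x * f' x)"
      by (rule integral_completion[symmetric]) (use f'(1) ind in simp)
    also have "\<dots> = (LINT x|lebesgue. indicator (box a b) x * f x)"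
    proof (rule integral_cong_AE)
      show "AE x in lebesgue. indicator (box a b) x * f' x = indicator (box a b) x * f x"
        using AE by eventually_elim simp
    qed (use f'_leb borel_measurable_integrable[OF f] measurable_completion[OF ind] in simp_all)
    also have "\<dots> = (LINT x|lebesgue. indicator \<Omega> x *\<^sub>R (indicator (box a b) x * g x))"
      by (simp add: f_def mult.left_commute)
    also have "\<dots> = (LINT x|lebesgue_on \<Omega>. indicator (box a b) x * g x)"
      by (rule integral_restrict_space[OF \<Omega>, symmetric])
    finally show ?thesis using box[OF that] by simp
  qed
  have local: "AE x in lborel. x \<in> box a b \<longrightarrow> f' x = 0" if ab: "cbox a b \<subseteq> \<Omega>" for a b
  proof -
    let ?h = "\<lambda>x. indicator (box a b) x * f' x"
    have h: "integrable lborel ?h"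
      using integrable_mult_indicator[OF _ int, of "box a b"] by simp
    have "(LINT x:box c d|lborel. ?h x) = 0" for c d
    proof -
      \<comment> \<open>Corners of the intersection of the two boxes. The closed box
        \<open>cbox p q\<close> lies in \<open>cbox a b\<close>, so \<open>boxf'\<close> applies to
        it, also when it is empty.\<close>
      define p q where "p = (\<Sum>i\<in>Basis. max (a\<bullet>i) (c\<bullet>i) *\<^sub>R i)" and "q = (\<Sum>i\<in>Basis. min (b\<bullet>i) (d\<bullet>i) *\<^sub>R i)"
      have "box a b \<inter> box c d = box p q" by (simp add: box_Int_box p_def q_def)
      have "(\<lambda>x. indicator (box c d) x *\<^sub>R ?h x) = (\<lambda>x. indicator (box p q) x * f' x)"
        by (simp add: \<open>box a b \<inter> box c d = box p q\<close>[symmetric] indicator_inter_arith mult_ac)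
      moreover have "cbox p q \<subseteq> \<Omega>"
        using ab Int_interval[of a b c d] unfolding p_def q_def by blast
      ultimately show ?thesis unfolding set_lebesgue_integral_def by (simp only: boxf')
    qed
    from integral_zero_on_borel_sets[OF h boxf'[OF ab] this] have "AE x in lborel. ?h x = 0"
      by (rule AE_zero_if_integral_zero_on_borel_sets[OF h])
    then show ?thesis by eventually_elim (simp add: indicator_def split: if_splits)
  qed
  let ?F = "{box a b | a b. cbox a b \<subseteq> \<Omega>}"
  obtain F where F: "F \<subseteq> ?F" "countable F" "\<Union>F = \<Union>?F"
    by (rule Lindelof[of ?F]) auto
  have F_zero: "AE x in lborel. \<forall>B\<in>F. x \<in> B \<longrightarrow> f' x = 0"
    using F(2) by (subst AE_ball_countable) (use F(1) local in auto)
  have cover: "\<Omega> \<subseteq> \<Union>F"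
  proof
    fix x assume "x \<in> \<Omega>"
    then obtain a b where "cbox a b \<subseteq> \<Omega>" "x \<in> box a b"
      using open_contains_cbox[OF \<open>open \<Omega>\<close>] by metis
    then show "x \<in> \<Union>F" unfolding F(3) by blast
  qed
  have "AE x in lborel. x \<in> \<Omega> \<longrightarrow> g x = 0"
    using F_zero f'(2)
  proof eventually_elim
    case (elim x)
    then show ?case using cover by (auto simp: f_def)
  qed
  then have "AE x in lebesgue. x \<in> \<Omega> \<longrightarrow> g x = 0" by (rule AE_completion)
  then show ?thesis by (simp add: AE_restrict_space_iff[OF \<Omega>])
qed

text \<open>The fundamental lemma of the calculus of variations. The bumps from
  \<open>box_test_functions\<close> are bounded by 1, so |g| dominates and the test integrals
  converge to the integral over the box.\<close>

lemma AE_zero_if_test_integrals_zero: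
  fixes g :: "real^'n \<Rightarrow> real"
  assumes "open \<Omega>" and g: "integrable (lebesgue_on \<Omega>) g"
    and test: "\<And>\<phi>. test_function \<Omega> \<phi> \<Longrightarrow> (LINT x|lebesgue_on \<Omega>. \<phi> x * g x) = 0"
  shows "AE x in lebesgue_on \<Omega>. g x = 0"
proof (rule AE_zero_if_box_integrals_zero[OF assms(1,2)])
  fix a b :: "real^'n" assume "cbox a b \<subseteq> \<Omega>"
  then obtain \<phi> where \<phi>: "\<And>m::nat. test_function \<Omega> (\<phi> m)" "\<And>m x. \<bar>\<phi> m x\<bar> \<le> 1"
    "\<And>x. (\<lambda>m. \<phi> m x) \<longlonglongrightarrow> indicator (box a b) x"
    using box_test_functions by metis
  note gm = borel_measurable_integrable[OF g]
  have \<phi>m: "\<phi> m \<in> borel_measurable (lebesgue_on \<Omega>)" for m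
    using \<phi>(1)[of m] unfolding test_function_def
    by (intro borel_measurable_continuous_lebesgue_on smooth_continuous_on) simp
  have "(\<lambda>m. LINT x|lebesgue_on \<Omega>. \<phi> m x * g x) \<longlonglongrightarrow> (LINT x|lebesgue_on \<Omega>. indicator (box a b) x * g x)"
  proof (rule integral_dominated_convergence)
    show "integrable (lebesgue_on \<Omega>) (\<lambda>x. \<bar>g x\<bar>)" using g by simp
    have "(\<lambda>x. indicator (box a b) x :: real) \<in> borel_measurable (lebesgue_on \<Omega>)"
      by (rule borel_measurable_lebesgue_on) simp
    with gm show "(\<lambda>x. indicator (box a b) x * g x) \<in> borel_measurable (lebesgue_on \<Omega>)" by simp
    show "(\<lambda>x. \<phi> m x * g x) \<in> borel_measurable (lebesgue_on \<Omega>)" for m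
      using gm \<phi>m by simp
    show "AE x in lebesgue_on \<Omega>. (\<lambda>m. \<phi> m x * g x) \<longlonglongrightarrow> indicator (box a b) x * g x"
      using \<phi>(3) by (intro AE_I2 tendsto_mult tendsto_const)
    show "AE x in lebesgue_on \<Omega>. norm (\<phi> m x * g x) \<le> \<bar>g x\<bar>" for m
      using \<phi>(2)[of m] by (intro AE_I2) (simp add: abs_mult mult_left_le_one_le)
  qed
  then have "(\<lambda>m::nat. 0) \<longlonglongrightarrow> (LINT x|lebesgue_on \<Omega>. indicator (box a b) x * g x)"
    using test[OF \<phi>(1)] by simp
  then show "(LINT x|lebesgue_on \<Omega>. indicator (box a b) x * g x) = 0"
    using LIMSEQ_unique tendsto_const by blast
qed

lemma weak_gradient_unique:
  fixes \<Omega> :: "(real^'n) set"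
  assumes "bounded \<Omega>" "open \<Omega>"
    and g: "g \<in> L2_space (lebesgue_on \<Omega>)" "is_weak_gradient \<Omega> u g"
    and h: "h \<in> L2_space (lebesgue_on \<Omega>)" "is_weak_gradient \<Omega> u h"
  shows "AE x in lebesgue_on \<Omega>. g x = h x"
proof -
  note fin = finite_measure_lebesgue_on_bounded[OF assms(1,2)]
  note ig = L2_space_integrable[OF fin g(1)] and ih = L2_space_integrable[OF fin h(1)]
  \<comment> \<open>Test functions are scalar, so the vector field g - h is tested in one direction
    at a time; the finitely many basis directions are united afterwards.\<close>
  have "AE x in lebesgue_on \<Omega>. (g x - h x) \<bullet> e = 0" for e
  proof (rule AE_zero_if_test_integrals_zero[OF assms(2)])
    show "integrable (lebesgue_on \<Omega>) (\<lambda>x. (g x - h x) \<bullet> e)"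
      using ig ih by simp
    fix \<phi> assume \<phi>: "test_function \<Omega> \<phi>"
    then have "smooth \<phi>" by (simp add: test_function_def)
    then obtain D where D: "\<And>x. GDERIV \<phi> x :> D x" using smooth_has_gradient by blast
    \<comment> \<open>The zero function fills the scalar slot of
      \<open>test_function_integrable\<close>; the second conclusion concerns the vector field
      alone.\<close>
    note ig' = test_function_integrable(2)[OF \<phi> D integrable_zero ig]
      and ih' = test_function_integrable(2)[OF \<phi> D integrable_zero ih]
    have eq: "(LINT x|lebesgue_on \<Omega>. \<phi> x *\<^sub>R g x) = (LINT x|lebesgue_on \<Omega>. \<phi> x *\<^sub>R h x)"
    proof -
      have "(LINT x|lebesgue_on \<Omega>. u x *\<^sub>R D x) = - (LINT x|lebesgue_on \<Omega>. \<phi> x *\<^sub>R g x)"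
        using g(2) \<phi> D unfolding is_weak_gradient_def by blast
      moreover have "(LINT x|lebesgue_on \<Omega>. u x *\<^sub>R D x) = - (LINT x|lebesgue_on \<Omega>. \<phi> x *\<^sub>R h x)"
        using h(2) \<phi> D unfolding is_weak_gradient_def by blast
      ultimately show ?thesis by simp
    qed
    have "(LINT x|lebesgue_on \<Omega>. \<phi> x * ((g x - h x) \<bullet> e)) =
        (LINT x|lebesgue_on \<Omega>. (\<phi> x *\<^sub>R g x - \<phi> x *\<^sub>R h x) \<bullet> e)"
      by (simp add: inner_diff_left right_diff_distrib)
    also have "\<dots> = (LINT x|lebesgue_on \<Omega>. \<phi> x *\<^sub>R g x - \<phi> x *\<^sub>R h x) \<bullet> e"
      by (rule integral_inner_left) (rule Bochner_Integration.integrable_diff[OF ig' ih'])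
    also have "\<dots> = 0"
      by (subst Bochner_Integration.integral_diff[OF ig' ih']) (simp add: eq)
    finally show "(LINT x|lebesgue_on \<Omega>. \<phi> x * ((g x - h x) \<bullet> e)) = 0" .
  qed
  then have "AE x in lebesgue_on \<Omega>. \<forall>e\<in>Basis. (g x - h x) \<bullet> e = 0"
    by (subst AE_ball_countable) (auto intro: countable_finite)
  then show ?thesis
    by eventually_elim (simp add: euclidean_eq_iff[of "g _"] inner_diff_left)
qed

section \<open>The Sobolev norm\<close>

lemma H1_D:
  assumes "u \<in> H1 \<Omega>"
  shows "u \<in> L2_space (lebesgue_on \<Omega>)" "wgrad \<Omega> u \<in> L2_space (lebesgue_on \<Omega>)"
    "is_weak_gradient \<Omega> u (wgrad \<Omega> u)"
proof -
  show "u \<in> L2_space (lebesgue_on \<Omega>)" using assms by (simp add: H1_def)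
  have "\<exists>g. g \<in> L2_space (lebesgue_on \<Omega>) \<and> is_weak_gradient \<Omega> u g"
    using assms by (auto simp: H1_def)
  from someI_ex[OF this]
  show "wgrad \<Omega> u \<in> L2_space (lebesgue_on \<Omega>)" "is_weak_gradient \<Omega> u (wgrad \<Omega> u)"
    unfolding wgrad_def by blast+
qed

text \<open>This is how the arbitrary choice \<open>wgrad\<close> is computed: any explicit square
  integrable weak gradient agrees with it almost everywhere.\<close>

lemma wgrad_AE_eq:
  assumes "bounded \<Omega>" "open \<Omega>" "u \<in> L2_space (lebesgue_on \<Omega>)"
    and g: "g \<in> L2_space (lebesgue_on \<Omega>)" "is_weak_gradient \<Omega> u g"
  shows "u \<in> H1 \<Omega>" "AE x in lebesgue_on \<Omega>. wgrad \<Omega> u x = g x"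
proof -
  show u: "u \<in> H1 \<Omega>" using assms by (auto simp: H1_def)
  show "AE x in lebesgue_on \<Omega>. wgrad \<Omega> u x = g x"
    by (rule weak_gradient_unique[OF assms(1,2) H1_D(2,3)[OF u] g])
qed

lemma H1_lincomb:
  assumes "bounded \<Omega>" "open \<Omega>" "u \<in> H1 \<Omega>" "v \<in> H1 \<Omega>"
  shows "(\<lambda>x. u x + c * v x) \<in> H1 \<Omega>"
    and "AE x in lebesgue_on \<Omega>. wgrad \<Omega> (\<lambda>x. u x + c * v x) x = wgrad \<Omega> u x + c *\<^sub>R wgrad \<Omega> v x"
proof -
  note u = H1_D[OF assms(3)] and v = H1_D[OF assms(4)]
  have L2: "(\<lambda>x. u x + c * v x) \<in> L2_space (lebesgue_on \<Omega>)"
    using L2_space_lincomb[OF u(1) v(1), of c] by simp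
  note * = wgrad_AE_eq[OF assms(1,2) L2 L2_space_lincomb[OF u(2) v(2)]
      is_weak_gradient_lincomb[OF assms(1,2) u v]]
  show "(\<lambda>x. u x + c * v x) \<in> H1 \<Omega>" by (rule *(1))
  show "AE x in lebesgue_on \<Omega>. wgrad \<Omega> (\<lambda>x. u x + c * v x) x = wgrad \<Omega> u x + c *\<^sub>R wgrad \<Omega> v x"
    by (rule *(2))
qed

lemma H1_diff:
  assumes "bounded \<Omega>" "open \<Omega>" "u \<in> H1 \<Omega>" "v \<in> H1 \<Omega>"
  shows "u - v \<in> H1 \<Omega>"
  using H1_lincomb(1)[OF assms, of "- 1"] by (simp add: fun_diff_def)

lemma H1_norm_nonneg: "0 \<le> H1_norm \<Omega> u"
  by (simp add: H1_norm_def)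

lemma dom_norm_le_H1_norm: "dom_norm \<Omega> u \<le> H1_norm \<Omega> u"
  unfolding H1_norm_def by (rule real_le_rsqrt) simp

text \<open>The L2 triangle inequality is applied to the functions and to their gradients; the
  Euclidean triangle inequality in the plane then combines the two under the square root.\<close>

lemma H1_norm_add:
  assumes "bounded \<Omega>" "open \<Omega>" "u \<in> H1 \<Omega>" "v \<in> H1 \<Omega>"
  shows "H1_norm \<Omega> (\<lambda>x. u x + v x) \<le> H1_norm \<Omega> u + H1_norm \<Omega> v"
proof -
  let ?L = "L2_norm (lebesgue_on \<Omega>)" and ?w = "\<lambda>x. u x + v x"
  note u = H1_D[OF assms(3)] and v = H1_D[OF assms(4)]
  have w: "?w \<in> H1 \<Omega>" using H1_lincomb(1)[OF assms, of 1] by simp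
  have "?L (wgrad \<Omega> ?w) = ?L (\<lambda>x. wgrad \<Omega> u x + wgrad \<Omega> v x)"
  proof (rule L2_norm_cong_AE)
    show "AE x in lebesgue_on \<Omega>. wgrad \<Omega> ?w x = wgrad \<Omega> u x + wgrad \<Omega> v x"
      using H1_lincomb(2)[OF assms, of 1] by simp
  qed (use L2_space_D(1)[OF H1_D(2)[OF w]] L2_space_D(1)[OF u(2)] L2_space_D(1)[OF v(2)] in simp_all)
  then have grad: "?L (wgrad \<Omega> ?w) \<le> ?L (wgrad \<Omega> u) + ?L (wgrad \<Omega> v)"
    using L2_norm_triangle[OF u(2) v(2)] by simp
  have "H1_norm \<Omega> ?w \<le> sqrt ((?L u + ?L v)\<^sup>2 + (?L (wgrad \<Omega> u) + ?L (wgrad \<Omega> v))\<^sup>2)"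
    unfolding H1_norm_def dom_norm_def
    by (intro real_sqrt_le_mono add_mono power_mono L2_norm_triangle u v grad L2_norm_nonneg)
  also have "\<dots> \<le> H1_norm \<Omega> u + H1_norm \<Omega> v"
    unfolding H1_norm_def dom_norm_def by (rule real_sqrt_sum_squares_triangle_ineq)
  finally show ?thesis .
qed

text \<open>Keeps a network close to a function of bounded norm inside a slightly larger
  ball.\<close>

lemma H1_norm_le_diff:
  assumes "bounded \<Omega>" "open \<Omega>" "u \<in> H1 \<Omega>" "v \<in> H1 \<Omega>"
  shows "H1_norm \<Omega> u \<le> H1_norm \<Omega> (u - v) + H1_norm \<Omega> v"
  using H1_norm_add[OF assms(1,2) H1_diff[OF assms] assms(4)] by simp

lemma H1_norm_diff_triangle:
  assumes "bounded \<Omega>" "open \<Omega>" "u \<in> H1 \<Omega>" "v \<in> H1 \<Omega>" "w \<in> H1 \<Omega>"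
  shows "H1_norm \<Omega> (u - w) \<le> H1_norm \<Omega> (u - v) + H1_norm \<Omega> (v - w)"
proof -
  have "(\<lambda>x. (u - v) x + (v - w) x) = u - w" by (simp add: fun_diff_def)
  then show ?thesis
    using H1_norm_add[OF assms(1,2) H1_diff[OF assms(1-4)] H1_diff[OF assms(1,2,4,5)]] by simp
qed

section \<open>Smooth functions belong to the Sobolev spaces\<close>

text \<open>Bounds difference quotients uniformly in the step size, as dominated convergence
  requires.\<close>

lemma lipschitz_of_bounded_gradient:
  fixes \<zeta> :: "'a::real_inner \<Rightarrow> real"
  assumes "\<And>x. GDERIV \<zeta> x :> D x" "\<And>x. norm (D x) \<le> B"
  shows "\<bar>\<zeta> y - \<zeta> x\<bar> \<le> B * norm (y - x)"
proof -
  have "onorm (\<lambda>h. h \<bullet> D x) \<le> B" for x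
  proof (rule onorm_bound)
    show "0 \<le> B" using order_trans[OF norm_ge_zero assms(2)] .
    fix h
    have "norm (h \<bullet> D x) \<le> norm h * norm (D x)" using Cauchy_Schwarz_ineq2 by simp
    also have "\<dots> \<le> norm h * B" using assms(2) by (intro mult_left_mono) auto
    finally show "norm (h \<bullet> D x) \<le> B * norm h" by (simp add: mult.commute)
  qed
  moreover have "(\<zeta> has_derivative (\<lambda>h. h \<bullet> D x)) (at x within UNIV)" for x
    using assms(1)[of x] by (simp add: gderiv_def)
  ultimately show ?thesis
    using differentiable_bound[OF convex_UNIV, of \<zeta> "\<lambda>x h. h \<bullet> D x" B y x] by simp
qed

lemma directional_quotient_tendsto:
  assumes "GDERIV \<zeta> x :> d"
  shows "(\<lambda>m. (\<zeta> (x + inverse (real (Suc m)) *\<^sub>R e) - \<zeta> x) / inverse (real (Suc m))) \<longlonglongrightarrow> d \<bullet> e"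
proof -
  have "((\<lambda>t. x + t *\<^sub>R e) has_derivative (\<lambda>t. t *\<^sub>R e)) (at 0)"
    by (auto intro!: derivative_eq_intros)
  moreover have "(\<zeta> has_derivative (\<lambda>h. h \<bullet> d)) (at (x + 0 *\<^sub>R e))"
    using assms by (simp add: gderiv_def)
  ultimately have "((\<lambda>t. \<zeta> (x + t *\<^sub>R e)) has_derivative (\<lambda>t. (t *\<^sub>R e) \<bullet> d)) (at 0)"
    by (rule has_derivative_compose)
  then have "((\<lambda>t. \<zeta> (x + t *\<^sub>R e)) has_real_derivative d \<bullet> e) (at 0)"
    by (simp add: has_field_derivative_def inner_commute mult.commute[of _ "d \<bullet> e"] fun_eq_iff)
  then have "((\<lambda>t. (\<zeta> (x + t *\<^sub>R e) - \<zeta> x) / t) \<longlongrightarrow> d \<bullet> e) (at 0)"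
    by (simp add: has_field_derivative_iff)
  moreover have "filterlim (\<lambda>m. inverse (real (Suc m))) (at 0) sequentially"
    unfolding filterlim_at using LIMSEQ_inverse_real_of_nat by simp
  ultimately show ?thesis by (rule filterlim_compose)
qed

lemma lborel_integral_translation:
  fixes f :: "'a::euclidean_space \<Rightarrow> real"
  assumes "integrable lborel f"
  shows "integrable lborel (\<lambda>x. f (x + c))" "(LINT x|lborel. f (x + c)) = integral\<^sup>L lborel f"
proof -
  have f: "f \<in> borel_measurable borel" using borel_measurable_integrable[OF assms] by simp
  have c: "(+) c \<in> measurable lborel borel" by simp
  show "integrable lborel (\<lambda>x. f (x + c))"
    using integrable_distr_eq[OF c f] assms by (simp add: lborel_distr_plus add.commute)
  show "(LINT x|lborel. f (x + c)) = integral\<^sup>L lborel f"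
    using integral_distr[OF c f] by (simp add: lborel_distr_plus add.commute)
qed

text \<open>Integrals are invariant under translation, so all difference quotients integrate to zero.\<close>

lemma integral_gradient_compact_support:
  fixes \<zeta> :: "real^'n \<Rightarrow> real"
  assumes \<zeta>: "smooth \<zeta>" "\<And>x. GDERIV \<zeta> x :> D x" and S: "compact (closure {x. \<zeta> x \<noteq> 0})"
  shows "(LINT x|lborel. D x \<bullet> e) = 0"
proof -
  have test: "test_function UNIV \<zeta>" using \<zeta>(1) S by (simp add: test_function_def)
  obtain B where B: "\<And>x. \<bar>\<zeta> x\<bar> \<le> B" "\<And>x. norm (D x) \<le> B"
    using test_function_bounds[OF test \<zeta>(2)] by blast
  obtain R where R: "\<And>x. x \<in> closure {x. \<zeta> x \<noteq> 0} \<Longrightarrow> norm x \<le> R"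
    using compact_imp_bounded[OF S] unfolding bounded_iff by blast
  have out: "\<zeta> x = 0" if "norm x > R" for x
    using R[of x] that closure_subset[of "{x. \<zeta> x \<noteq> 0}"] by auto
  \<comment> \<open>The steps \<open>t m\<close> are at most 1. A point of norm above R + norm e,
    and its translate, therefore both lie where \<open>\<zeta>\<close> vanishes, so one ball
    contains the supports of all difference quotients.\<close>
  define C where "C = cball (0 :: real^'n) (R + norm e)"
  have C: "integrable lborel (indicator C :: real^'n \<Rightarrow> real)"
    unfolding C_def by (rule integrable_real_indicator, simp, rule emeasure_lborel_cball_finite)
  have \<zeta>m: "\<zeta> \<in> borel_measurable lborel"
    using borel_measurable_continuous_onI[OF smooth_continuous_on[OF \<zeta>(1)]] by simp
  have Dm: "(\<lambda>x. D x \<bullet> e) \<in> borel_measurable lborel"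
    using borel_measurable_continuous_onI[OF smooth_gradient_continuous[OF \<zeta>]] by simp
  have int: "integrable lborel \<zeta>"
  proof (rule Bochner_Integration.integrable_bound)
    show "integrable lborel (\<lambda>x. B * indicator C x)" using C by simp
    have "\<bar>\<zeta> x\<bar> \<le> \<bar>B * indicator C x\<bar>" for x
    proof (cases "x \<in> C")
      case True
      then show ?thesis using B(1)[of x] by simp
    next
      case False
      then have "norm x > R" using norm_ge_zero[of e] unfolding C_def by (simp del: norm_ge_zero)
      then show ?thesis using out by simp
    qed
    then show "AE x in lborel. norm (\<zeta> x) \<le> norm (B * indicator C x)" by simp
  qed (rule \<zeta>m)
  define t where "t m = inverse (real (Suc m))" for m
  have t: "t m > 0" "t m \<le> 1" for m by (simp_all add: t_def field_simps)
  define q where "q m x = (\<zeta> (x + t m *\<^sub>R e) - \<zeta> x) / t m" for m x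
  have q0: "integral\<^sup>L lborel (q m) = 0" for m
    unfolding q_def using lborel_integral_translation[OF int, of "t m *\<^sub>R e"] int by simp
  have "(\<lambda>m. integral\<^sup>L lborel (q m)) \<longlonglongrightarrow> (LINT x|lborel. D x \<bullet> e)"
  proof (rule integral_dominated_convergence)
    show "integrable lborel (\<lambda>x. B * norm e * indicator C x)" using C by simp
    show "q m \<in> borel_measurable lborel" for m
      using lborel_integral_translation(1)[OF int, of "t m *\<^sub>R e"] int
      unfolding q_def by (intro borel_measurable_integrable) simp
    show "AE x in lborel. (\<lambda>m. q m x) \<longlonglongrightarrow> D x \<bullet> e"
      unfolding q_def t_def by (intro AE_I2 directional_quotient_tendsto \<zeta>(2))
    have "\<bar>q m x\<bar> \<le> B * norm e * indicator C x" for m x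
    proof (cases "x \<in> C")
      case True
      have "\<bar>\<zeta> (x + t m *\<^sub>R e) - \<zeta> x\<bar> \<le> B * norm (t m *\<^sub>R e)"
        using lipschitz_of_bounded_gradient[OF \<zeta>(2) B(2), of "x + t m *\<^sub>R e" x] by simp
      then have "\<bar>q m x\<bar> * t m \<le> B * norm e * t m"
        using t(1)[of m] by (simp add: q_def abs_divide mult_ac)
      then have "\<bar>q m x\<bar> \<le> B * norm e" by (rule mult_right_le_imp_le[OF _ t(1)])
      with True show ?thesis by simp
    next
      case False
      then have x: "norm x > R + norm e" by (simp add: C_def)
      have "norm (t m *\<^sub>R e) \<le> norm e" using t[of m] by (simp add: mult_left_le_one_le)
      moreover have "norm x \<le> norm (x + t m *\<^sub>R e) + norm (t m *\<^sub>R e)"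
        using norm_triangle_ineq4[of "x + t m *\<^sub>R e" "t m *\<^sub>R e"] by simp
      ultimately have "norm (x + t m *\<^sub>R e) > R" using x by linarith
      moreover have "norm x > R" using x norm_ge_zero[of e] by linarith
      ultimately show ?thesis using False out by (simp add: q_def)
    qed
    then show "AE x in lborel. norm (q m x) \<le> B * norm e * indicator C x" for m by simp
  qed (rule Dm)
  then show ?thesis using q0 by (simp add: LIMSEQ_const_iff)
qed

section \<open>Integration by parts and membership of smooth functions in H1 and H2\<close>

lemma continuous_in_L2_space:
  fixes f :: "real^'n \<Rightarrow> 'b::euclidean_space"
  assumes "bounded \<Omega>" "open \<Omega>" "continuous_on UNIV f"
  shows "f \<in> L2_space (lebesgue_on \<Omega>)"
proof -
  interpret finite_measure "lebesgue_on \<Omega>"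
    by (rule finite_measure_lebesgue_on_bounded[OF assms(1,2)])
  have "bounded (f ` closure \<Omega>)"
    using assms(1) by (intro compact_imp_bounded compact_continuous_image continuous_on_subset[OF assms(3)])
      (auto simp: compact_closure)
  then obtain B where B: "\<And>x. x \<in> closure \<Omega> \<Longrightarrow> norm (f x) \<le> B"
    unfolding bounded_iff by blast
  have meas: "f \<in> borel_measurable (lebesgue_on \<Omega>)"
    by (rule borel_measurable_continuous_lebesgue_on[OF assms(3)])
  have "integrable (lebesgue_on \<Omega>) (\<lambda>x. (norm (f x))\<^sup>2)"
  proof (rule integrable_const_bound)
    have "(norm (f x))\<^sup>2 \<le> B\<^sup>2" if "x \<in> \<Omega>" for x
      using B[of x] that closure_subset[of \<Omega>] by (intro power_mono) auto
    then show "AE x in lebesgue_on \<Omega>. norm ((norm (f x))\<^sup>2) \<le> B\<^sup>2"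
      by (intro AE_I2) simp
  qed (use meas in simp)
  with meas show ?thesis by (simp add: L2_space_def)
qed

text \<open>The sum of the two integrands is the gradient of the product of \<open>\<phi>\<close>
  with the test function, hence of a compactly supported smooth function, and integrates to
  zero.\<close>

lemma smooth_is_weak_gradient:
  fixes \<Omega> :: "(real^'n) set"
  assumes "bounded \<Omega>" "open \<Omega>" and \<phi>: "smooth \<phi>" "\<And>x. GDERIV \<phi> x :> D x"
  shows "is_weak_gradient \<Omega> \<phi> D"
  unfolding is_weak_gradient_def
proof (intro allI impI)
  fix \<eta> :: "real^'n \<Rightarrow> real" and E
  assume \<eta>: "test_function \<Omega> \<eta>" and "\<forall>x. GDERIV \<eta> x :> E x"
  then have E: "\<And>x. GDERIV \<eta> x :> E x" by blast
  have s\<eta>: "smooth \<eta>" using \<eta> by (simp add: test_function_def)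
  note fin = finite_measure_lebesgue_on_bounded[OF assms(1,2)]
  have \<Omega>: "\<Omega> \<inter> space lebesgue \<in> sets lebesgue" using \<open>open \<Omega>\<close> by simp
  have i\<phi>: "integrable (lebesgue_on \<Omega>) \<phi>"
    by (rule L2_space_integrable[OF fin continuous_in_L2_space[OF assms(1,2) smooth_continuous_on[OF \<phi>(1)]]])
  have iD: "integrable (lebesgue_on \<Omega>) D"
    by (rule L2_space_integrable[OF fin continuous_in_L2_space[OF assms(1,2) smooth_gradient_continuous[OF \<phi>]]])
  note i = test_function_integrable[OF \<eta> E i\<phi> iD]
  define G where "G x = \<phi> x *\<^sub>R E x + \<eta> x *\<^sub>R D x" for x
  have G: "GDERIV (\<lambda>x. \<phi> x * \<eta> x) x :> G x" for x
    unfolding G_def by (rule GDERIV_mult[OF \<phi>(2) E])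
  have sm: "smooth (\<lambda>x. \<phi> x * \<eta> x)" using \<phi>(1) s\<eta> by (rule smooth_mult)
  have "bounded {x. \<phi> x * \<eta> x \<noteq> 0}"
    using \<eta> unfolding test_function_def compact_closure by (auto intro: bounded_subset)
  then have comp: "compact (closure {x. \<phi> x * \<eta> x \<noteq> 0})" by (simp only: compact_closure)
  have iG: "integrable (lebesgue_on \<Omega>) G"
    unfolding G_def by (rule Bochner_Integration.integrable_add[OF i])
  \<comment> \<open>Allows the integral over the domain to be replaced by one over the whole space,
    where the translation argument applies.\<close>
  have G_out: "G x = 0" if "x \<notin> \<Omega>" for x
  proof -
    have "\<eta> x = 0" by (rule test_function_zero_outside[OF \<eta> that])
    moreover have "x \<notin> closure {x. \<eta> x \<noteq> 0}"
      using that \<eta> unfolding test_function_def by blast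
    then have "E x = 0" by (rule GDERIV_zero_outside_support[OF E])
    ultimately show ?thesis by (simp add: G_def)
  qed
  have Gm: "G \<in> borel_measurable lborel"
    using borel_measurable_continuous_onI[OF smooth_gradient_continuous[OF sm G]] by simp
  have "integral\<^sup>L (lebesgue_on \<Omega>) G \<bullet> e = 0" for e
  proof -
    have "integral\<^sup>L (lebesgue_on \<Omega>) G \<bullet> e = (LINT x|lebesgue_on \<Omega>. G x \<bullet> e)"
      by (rule integral_inner_left[symmetric]) (rule iG)
    also have "\<dots> = (LINT x|lebesgue. indicator \<Omega> x *\<^sub>R (G x \<bullet> e))"
      by (rule integral_restrict_space[OF \<Omega>])
    also have "\<dots> = (LINT x|lebesgue. G x \<bullet> e)"
      by (rule Bochner_Integration.integral_cong) (auto simp: indicator_def G_out)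
    also have "\<dots> = (LINT x|lborel. G x \<bullet> e)"
      by (rule integral_completion) (use Gm in simp)
    also have "\<dots> = 0" by (rule integral_gradient_compact_support[OF sm G comp])
    finally show ?thesis .
  qed
  \<comment> \<open>Taking the integral itself as the direction e turns the inner product into its
    squared norm.\<close>
  from this[of "integral\<^sup>L (lebesgue_on \<Omega>) G"]
  have "integral\<^sup>L (lebesgue_on \<Omega>) G = 0" by (simp only: inner_eq_zero_iff)
  then show "(LINT x|lebesgue_on \<Omega>. \<phi> x *\<^sub>R E x) = - (LINT x|lebesgue_on \<Omega>. \<eta> x *\<^sub>R D x)"
    unfolding G_def Bochner_Integration.integral_add[OF i] by (simp add: eq_neg_iff_add_eq_0)
qed

text \<open>\<open>H2\<close> refers to the components of the chosen representative
  \<open>wgrad\<close>, which for a smooth function equal the smooth partial derivatives only almost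
  everywhere.\<close>

lemma is_weak_gradient_cong_AE:
  assumes "is_weak_gradient \<Omega> u g" "AE x in lebesgue_on \<Omega>. v x = u x"
    and "u \<in> borel_measurable (lebesgue_on \<Omega>)" "v \<in> borel_measurable (lebesgue_on \<Omega>)"
  shows "is_weak_gradient \<Omega> v g"
  unfolding is_weak_gradient_def
proof (intro allI impI)
  fix \<phi> D assume \<phi>: "test_function \<Omega> \<phi>" "\<forall>x. GDERIV \<phi> x :> D x"
  then have "smooth \<phi>" by (simp add: test_function_def)
  have D: "D \<in> borel_measurable (lebesgue_on \<Omega>)"
    by (rule borel_measurable_continuous_lebesgue_on[OF
          smooth_gradient_continuous[OF \<open>smooth \<phi>\<close> \<phi>(2)[rule_format]]])
  have "(LINT x|lebesgue_on \<Omega>. v x *\<^sub>R D x) = (LINT x|lebesgue_on \<Omega>. u x *\<^sub>R D x)"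
  proof (rule integral_cong_AE)
    show "AE x in lebesgue_on \<Omega>. v x *\<^sub>R D x = u x *\<^sub>R D x"
      using assms(2) by eventually_elim simp
  qed (use assms(3,4) D in simp_all)
  then show "(LINT x|lebesgue_on \<Omega>. v x *\<^sub>R D x) = - (LINT x|lebesgue_on \<Omega>. \<phi> x *\<^sub>R g x)"
    using assms(1) \<phi> unfolding is_weak_gradient_def by simp
qed

lemma smooth_in_H1:
  fixes \<Omega> :: "(real^'n) set"
  assumes "bounded \<Omega>" "open \<Omega>" and \<phi>: "smooth \<phi>" "\<And>x. GDERIV \<phi> x :> D x"
  shows "\<phi> \<in> H1 \<Omega>" "AE x in lebesgue_on \<Omega>. wgrad \<Omega> \<phi> x = D x"
proof -
  have "\<phi> \<in> L2_space (lebesgue_on \<Omega>)" "D \<in> L2_space (lebesgue_on \<Omega>)"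
    using continuous_in_L2_space[OF assms(1,2)] smooth_continuous_on[OF \<phi>(1)]
      smooth_gradient_continuous[OF \<phi>] by blast+
  from wgrad_AE_eq[OF assms(1,2) this smooth_is_weak_gradient[OF assms]]
  show "\<phi> \<in> H1 \<Omega>" "AE x in lebesgue_on \<Omega>. wgrad \<Omega> \<phi> x = D x" .
qed

lemma L2_space_component:
  fixes g :: "'a \<Rightarrow> real^'n"
  assumes "g \<in> L2_space M"
  shows "(\<lambda>x. g x $ i) \<in> L2_space M"
proof -
  have m: "(\<lambda>x. g x $ i) \<in> borel_measurable M"
    using L2_space_D(1)[OF assms] by (simp add: cart_eq_inner_axis)
  have "integrable M (\<lambda>x. (norm (g x $ i))\<^sup>2)"
  proof (rule Bochner_Integration.integrable_bound[OF L2_space_D(2)[OF assms]])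
    have "(norm (g x $ i))\<^sup>2 \<le> (norm (g x))\<^sup>2" for x
      using component_le_norm_cart by (intro power_mono) simp_all
    then show "AE x in M. norm ((norm (g x $ i))\<^sup>2) \<le> norm ((norm (g x))\<^sup>2)" by simp
  qed (use m in simp)
  with m show ?thesis by (simp add: L2_space_def)
qed

lemma smooth_in_H2:
  fixes \<Omega> :: "(real^'n) set"
  assumes "bounded \<Omega>" "open \<Omega>" "smooth \<phi>"
  shows "\<phi> \<in> H2 \<Omega>"
proof -
  obtain D where D: "\<And>x. GDERIV \<phi> x :> D x" "\<And>i. smooth (\<lambda>x. D x $ i)"
    using smooth_has_gradient[OF assms(3)] by blast
  note \<phi> = smooth_in_H1[OF assms D(1)]
  have "(\<lambda>x. wgrad \<Omega> \<phi> x $ i) \<in> H1 \<Omega>" for i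
  proof -
    obtain E where E: "\<And>x. GDERIV (\<lambda>x. D x $ i) x :> E x"
      using smooth_has_gradient[OF D(2)] by blast
    note H = H1_D[OF smooth_in_H1(1)[OF assms(1,2) D(2) E]]
    have L2: "(\<lambda>x. wgrad \<Omega> \<phi> x $ i) \<in> L2_space (lebesgue_on \<Omega>)"
      by (rule L2_space_component[OF H1_D(2)[OF \<phi>(1)]])
    have "AE x in lebesgue_on \<Omega>. wgrad \<Omega> \<phi> x $ i = D x $ i"
      using \<phi>(2) by eventually_elim simp
    then have "is_weak_gradient \<Omega> (\<lambda>x. wgrad \<Omega> \<phi> x $ i) (wgrad \<Omega> (\<lambda>x. D x $ i))"
      by (rule is_weak_gradient_cong_AE[OF H(3) _ L2_space_D(1)[OF H(1)] L2_space_D(1)[OF L2]])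
    with L2 H(2) show ?thesis by (auto simp: H1_def)
  qed
  with \<phi>(1) show ?thesis by (simp add: H2_def)
qed

section \<open>The approximation error\<close>

text \<open>The L2 norm is part of the H1 norm and the boundary norm is controlled by the trace
  inequality. Absolute values appear because no sign is assumed for the weights or for the trace
  constant.\<close>

lemma weighted_norm_le:
  assumes "bdry_norm \<Omega> z \<le> C\<^sub>T * H1_norm \<Omega> z"
    and "\<bar>c\<^sub>1\<bar> \<le> d\<^sub>1" "\<bar>c\<^sub>2\<bar> \<le> d\<^sub>2" "\<bar>c\<^sub>3\<bar> \<le> d\<^sub>3" "H1_norm \<Omega> z \<le> \<delta>"
  shows "weighted_norm \<Omega> c\<^sub>1 c\<^sub>2 c\<^sub>3 z \<le> (d\<^sub>1 + d\<^sub>2 + d\<^sub>3 * \<bar>C\<^sub>T\<bar>) * \<delta>"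
proof -
  have *: "c * t \<le> d * s" if "\<bar>c\<bar> \<le> d" "0 \<le> t" "t \<le> s" for c d s t :: real
    using mult_mono[of c d t s] that by linarith
  have pos: "0 \<le> dom_norm \<Omega> z" "0 \<le> bdry_norm \<Omega> z"
    by (simp_all add: dom_norm_def bdry_norm_def L2_norm_nonneg)
  have "C\<^sub>T * H1_norm \<Omega> z \<le> \<bar>C\<^sub>T\<bar> * \<delta>"
    by (rule *[OF order_refl H1_norm_nonneg assms(5)])
  then have "bdry_norm \<Omega> z \<le> \<bar>C\<^sub>T\<bar> * \<delta>" using assms(1) by linarith
  from *[OF assms(4) pos(2) this] *[OF assms(2) H1_norm_nonneg assms(5)]
    *[OF assms(3) pos(1) order_trans[OF dom_norm_le_H1_norm assms(5)]]
  show ?thesis unfolding weighted_norm_def by (simp add: algebra_simps)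
qed

lemma small_radius:
  fixes \<epsilon> C :: real
  assumes "\<epsilon> > 0"
  obtains \<delta> where "\<delta> > 0" "\<delta> \<le> 1" "C * \<delta> \<le> \<epsilon>"
\<comment> \<open>The denominator 1 + |C| is positive and dominates C whatever its sign.\<close>
proof (rule that[of "min 1 (\<epsilon> / (1 + \<bar>C\<bar>))"])
  have "C * min 1 (\<epsilon> / (1 + \<bar>C\<bar>)) \<le> (1 + \<bar>C\<bar>) * (\<epsilon> / (1 + \<bar>C\<bar>))"
    using assms by (intro mult_mono) auto
  then show "C * min 1 (\<epsilon> / (1 + \<bar>C\<bar>)) \<le> \<epsilon>" by (simp split: if_splits)
qed (use assms in \<open>auto simp: add_pos_nonneg\<close>)

text \<open>One witness bounds each infimum from above, so no infimum has to be attained.\<close>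

lemma xi_app_le:
  assumes t: "\<And>v. v \<in> S \<Longrightarrow> \<exists>w\<in>Xt. weighted_norm \<Omega> K\<^sub>1 K\<^sub>2 K\<^sub>3 (w - v) \<le> \<epsilon> / 2"
    and s: "u \<in> Xs" "weighted_norm \<Omega> K\<^sub>4 K\<^sub>5 K\<^sub>6 (u - u\<^sub>0) \<le> \<epsilon> / 2"
  shows "xi_app \<Omega> S u\<^sub>0 Xs Xt K\<^sub>1 K\<^sub>2 K\<^sub>3 K\<^sub>4 K\<^sub>5 K\<^sub>6 \<le> ereal \<epsilon>"
proof -
  have "xi_app \<Omega> S u\<^sub>0 Xs Xt K\<^sub>1 K\<^sub>2 K\<^sub>3 K\<^sub>4 K\<^sub>5 K\<^sub>6 \<le> ereal (\<epsilon> / 2) + ereal (\<epsilon> / 2)"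
    unfolding xi_app_def
  proof (rule add_mono)
    show "(SUP v\<in>S. INF w\<in>Xt. ereal (weighted_norm \<Omega> K\<^sub>1 K\<^sub>2 K\<^sub>3 (w - v))) \<le> ereal (\<epsilon> / 2)"
    proof (rule SUP_least)
      fix v assume "v \<in> S"
      then obtain w where "w \<in> Xt" "weighted_norm \<Omega> K\<^sub>1 K\<^sub>2 K\<^sub>3 (w - v) \<le> \<epsilon> / 2" using t by blast
      then show "(INF w\<in>Xt. ereal (weighted_norm \<Omega> K\<^sub>1 K\<^sub>2 K\<^sub>3 (w - v))) \<le> ereal (\<epsilon> / 2)"
        by (intro INF_lower2[of w]) simp_all
    qed
    show "(INF u\<in>Xs. ereal (weighted_norm \<Omega> K\<^sub>4 K\<^sub>5 K\<^sub>6 (u - u\<^sub>0))) \<le> ereal (\<epsilon> / 2)"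
      using s by (intro INF_lower2[of u]) simp_all
  qed
  then show ?thesis by simp
qed

text \<open>The graph of the trace is built from smooth functions, so having a trace yields an
  approximation by elements of \<open>H2 \<Omega>\<close> without any density theorem.\<close>

lemma approximates_H2_has_trace:
  assumes "bounded \<Omega>" "open \<Omega>" "approximates_H2 \<Omega> F \<sigma>" "has_trace \<Omega> u g" "\<epsilon> > 0"
  obtains d w N where "N \<in> F d w \<sigma>" "N \<in> H1 \<Omega>" "H1_norm \<Omega> (N - u) \<le> \<epsilon>"
proof -
  obtain \<phi> :: "nat \<Rightarrow> real^'a \<Rightarrow> real" where u: "u \<in> H1 \<Omega>" and \<phi>: "\<And>j. smooth (\<phi> j)"
    "(\<lambda>j. H1_norm \<Omega> (\<phi> j - u)) \<longlonglongrightarrow> 0"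
    using assms(4) unfolding has_trace_def by blast
  have "\<forall>\<^sub>F j in sequentially. H1_norm \<Omega> (\<phi> j - u) < \<epsilon> / 2"
    using \<phi>(2) by (rule order_tendstoD) (use assms(5) in simp)
  then obtain j where j: "H1_norm \<Omega> (\<phi> j - u) < \<epsilon> / 2"
    by (auto simp: eventually_sequentially)
  have \<phi>j: "\<phi> j \<in> H2 \<Omega>" by (rule smooth_in_H2[OF assms(1,2) \<phi>(1)])
  then have \<phi>j1: "\<phi> j \<in> H1 \<Omega>" by (simp add: H2_def)
  have "\<epsilon> / 2 > 0" using assms(5) by simp
  then obtain d w N where N: "N \<in> F d w \<sigma>" "H1_norm \<Omega> (N - \<phi> j) \<le> \<epsilon> / 2"
    using assms(3) \<phi>j unfolding approximates_H2_def by blast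
  have N1: "N \<in> H1 \<Omega>" using N(1) assms(3) unfolding approximates_H2_def architecture_def by blast
  have "H1_norm \<Omega> (N - u) \<le> H1_norm \<Omega> (N - \<phi> j) + H1_norm \<Omega> (\<phi> j - u)"
    by (rule H1_norm_diff_triangle[OF assms(1,2) N1 \<phi>j1 u])
  also have "\<dots> \<le> \<epsilon>" using N(2) j by simp
  finally show thesis by (rule that[OF N(1) N1])
qed

theorem theorem27:
  fixes \<Omega> :: "(real^'n) set"
    and f h \<psi> uStar :: "real^'n \<Rightarrow> real"
    and K X Y :: "(real^'n \<Rightarrow> real) set"
    and b :: "real^'n"
    and k C\<^sub>a C\<^sub>b C\<^sub>T \<gamma> w_b1 w_b2 w_o1 w_o2 r Rbar P Q :: real
  assumes domain: "bounded_lipschitz_domain \<Omega>"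
    and f: "f \<in> L2_space (lebesgue_on \<Omega>)"
    and h: "h \<in> H_half \<Omega>"
    and psi: "\<psi> \<in> H1 \<Omega>"
    and psi_le_h: "AE x in surface_measure \<Omega>. bdry_trace \<Omega> \<psi> x \<le> h x"
    and K_def: "K = obstacle_set \<Omega> \<psi> h"
    and k: "k \<ge> 0"
    and C_pos: "C\<^sub>a > 0" "C\<^sub>b > 0"
    and A_lipschitz: "\<And>u v. u \<in> H1 \<Omega> \<Longrightarrow> v \<in> H1 \<Omega> \<Longrightarrow>
          dual_norm \<Omega> (operator_A \<Omega> b k u - operator_A \<Omega> b k v) \<le> C\<^sub>b * H1_norm \<Omega> (u - v)"
    and A_coercive: "\<And>u v. u \<in> H1 \<Omega> \<Longrightarrow> v \<in> H1 \<Omega> \<Longrightarrow>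
          (operator_A \<Omega> b k u - operator_A \<Omega> b k v) (u - v) \<ge> C\<^sub>a * (H1_norm \<Omega> (u - v))\<^sup>2"
    and uStar: "unique_solution_VI \<Omega> b k f K uStar"
    and gamma: "\<gamma> > 1 / (2 * C\<^sub>a)"
    and weights: "w_b1 \<ge> 0" "w_b2 \<ge> 0" "w_o1 \<ge> 0" "w_o2 \<ge> 0"
    and trace_const: "\<And>v. v \<in> H1 \<Omega> \<Longrightarrow> bdry_norm \<Omega> v \<le> C\<^sub>T * H1_norm \<Omega> v"
    and XY: "X \<subseteq> H1 \<Omega>" "Y \<subseteq> H1 \<Omega>" "uStar \<in> X \<inter> Y" "K \<inter> X \<subseteq> K \<inter> Y"
    and KY: "convex_fun_set (K \<inter> Y)" "H1_closed \<Omega> (K \<inter> Y)"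
    and r: "r > 0" "\<And>v. v \<in> K \<inter> Y \<Longrightarrow> dom_norm \<Omega> v \<le> r"
    and hyp1: "\<exists>Fs \<sigma>s. approximates_H2 \<Omega> Fs \<sigma>s"
    and hyp2: "\<exists>Ft \<sigma>t. approximates_uniformly \<Omega> Y Ft \<sigma>t"
    and hyp3: "Rbar > 0" "\<And>v. v \<in> K \<inter> Y \<Longrightarrow> H1_norm \<Omega> v \<le> Rbar"
    and P: "P \<ge> 1 + H1_norm \<Omega> uStar"
    and Q: "Q \<ge> 1 + Rbar"
  shows "\<forall>\<epsilon>>0. \<exists>Fs Ft \<sigma>s \<sigma>t ds ws dt wt.
    approximates_H2 \<Omega> Fs \<sigma>s \<and> approximates_uniformly \<Omega> Y Ft \<sigma>t \<and>
    (let Xs = Fs ds ws \<sigma>s \<inter> H1_ball \<Omega> P;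
         Xt = Ft dt wt \<sigma>t \<inter> H1_ball \<Omega> Q;
         Rstar = Max {P, Q, C\<^sub>T * P, C\<^sub>T * Q}
     in \<forall>Ms\<in>{0<..Rstar}. \<forall>Bs\<in>{0<..Rstar}. \<forall>Mt\<in>{0<..Rstar}. \<forall>Bt\<in>{0<..Rstar}.
          (\<forall>u\<in>Xs. H1_norm \<Omega> u \<le> Ms \<and> bdry_norm \<Omega> u \<le> Bs) \<longrightarrow>
          (\<forall>v\<in>Xt. H1_norm \<Omega> v \<le> Mt \<and> bdry_norm \<Omega> v \<le> Bt) \<longrightarrow>
          (let f_norm = dual_norm \<Omega> (L2_functional \<Omega> f);
               h_norm = L2_norm (surface_measure \<Omega>) h;
               C1 = dual_norm \<Omega> (operator_A \<Omega> b k uStar - L2_functional \<Omega> f);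
               K1 = C\<^sub>b * Ms + f_norm + 1 / \<gamma> * (Ms + Mt);
               K2 = w_o2 * (r + Mt + 2 * dom_norm \<Omega> \<psi>);
               K3 = 2 * w_b2 * (h_norm + Bt);
               K4 = C\<^sub>b * (Ms + Mt) + C1 + 1 / \<gamma> * (H1_norm \<Omega> uStar + Mt);
               K5 = w_o1 * (Ms + H1_norm \<Omega> uStar + 2 * dom_norm \<Omega> \<psi>);
               K6 = 2 * w_b1 * (h_norm + Bs)
           in xi_app \<Omega> (K \<inter> Y) uStar Xs Xt K1 K2 K3 K4 K5 K6 \<le> ereal \<epsilon>))"
proof (intro allI impI)
  fix \<epsilon> :: real assume \<epsilon>: "\<epsilon> > 0"
  have \<Omega>: "bounded \<Omega>" "open \<Omega>" using domain by (simp_all add: bounded_lipschitz_domain_def)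
  obtain Fs \<sigma>s where Fs: "approximates_H2 \<Omega> Fs \<sigma>s" using hyp1 by blast
  obtain Ft \<sigma>t where Ft: "approximates_uniformly \<Omega> Y Ft \<sigma>t" using hyp2 by blast
  have trace: "has_trace \<Omega> uStar h"
    using uStar by (simp add: unique_solution_VI_def solves_VI_def K_def obstacle_set_def)
  have uStar_H1: "uStar \<in> H1 \<Omega>" using trace by (simp add: has_trace_def)
  have "1 / (2 * C\<^sub>a) > 0" using C_pos by simp
  then have \<gamma>: "\<gamma> > 0" using gamma by linarith
  define R where "R = Max {P, Q, C\<^sub>T * P, C\<^sub>T * Q}"
  define f_norm where "f_norm = dual_norm \<Omega> (L2_functional \<Omega> f)"
  define h_norm where "h_norm = L2_norm (surface_measure \<Omega>) h"
  define C1 where "C1 = dual_norm \<Omega> (operator_A \<Omega> b k uStar - L2_functional \<Omega> f)"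
  define p where "p = dom_norm \<Omega> \<psi>"
  define U where "U = H1_norm \<Omega> uStar"
  have nn: "h_norm \<ge> 0" "p \<ge> 0" "U \<ge> 0"
    by (simp_all add: h_norm_def p_def U_def dom_norm_def L2_norm_nonneg H1_norm_nonneg)
  \<comment> \<open>\<open>D1\<close> to \<open>D6\<close> are the weights with every bound on the
    networks replaced by \<open>R\<close> and every dual norm by its absolute value. They depend
    only on data fixed so far, so the tolerances can be chosen before the networks.\<close>
  define D1 D2 D3 where "D1 = C\<^sub>b * R + \<bar>f_norm\<bar> + 1 / \<gamma> * (R + R)"
    and "D2 = w_o2 * (r + R + 2 * p)" and "D3 = 2 * w_b2 * (h_norm + R)"
  define D4 D5 D6 where "D4 = C\<^sub>b * (R + R) + \<bar>C1\<bar> + 1 / \<gamma> * (U + R)"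
    and "D5 = w_o1 * (R + U + 2 * p)" and "D6 = 2 * w_b1 * (h_norm + R)"
  obtain \<delta>t where \<delta>t: "\<delta>t > 0" "\<delta>t \<le> 1" "(D1 + D2 + D3 * \<bar>C\<^sub>T\<bar>) * \<delta>t \<le> \<epsilon> / 2"
    using small_radius[of "\<epsilon> / 2"] \<epsilon> half_gt_zero by blast
  obtain \<delta>s where \<delta>s: "\<delta>s > 0" "\<delta>s \<le> 1" "(D4 + D5 + D6 * \<bar>C\<^sub>T\<bar>) * \<delta>s \<le> \<epsilon> / 2"
    using small_radius[of "\<epsilon> / 2"] \<epsilon> half_gt_zero by blast
  obtain ds ws N where N: "N \<in> Fs ds ws \<sigma>s" "N \<in> H1 \<Omega>" "H1_norm \<Omega> (N - uStar) \<le> \<delta>s"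
    by (rule approximates_H2_has_trace[OF \<Omega> Fs trace \<delta>s(1)])
  obtain dt wt where dwt: "\<forall>y\<in>Y. \<exists>v\<in>Ft dt wt \<sigma>t. H1_norm \<Omega> (v - y) \<le> \<delta>t"
    using Ft \<delta>t(1) unfolding approximates_uniformly_def by blast
  define Xs where "Xs = Fs ds ws \<sigma>s \<inter> H1_ball \<Omega> P"
  define Xt where "Xt = Ft dt wt \<sigma>t \<inter> H1_ball \<Omega> Q"
  have "H1_norm \<Omega> N \<le> P"
    using H1_norm_le_diff[OF \<Omega> N(2) uStar_H1] N(3) \<delta>s(2) P by linarith
  then have N_Xs: "N \<in> Xs" using N by (simp add: Xs_def H1_ball_def)
  \<comment> \<open>Membership of the difference in H1 is recorded because the trace inequality is
    assumed for H1 functions.\<close>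
  have Xt: "\<exists>w\<in>Xt. w - v \<in> H1 \<Omega> \<and> H1_norm \<Omega> (w - v) \<le> \<delta>t" if v: "v \<in> K \<inter> Y" for v
  proof -
    obtain w where w: "w \<in> Ft dt wt \<sigma>t" "H1_norm \<Omega> (w - v) \<le> \<delta>t" using dwt v by blast
    have w1: "w \<in> H1 \<Omega>"
      using w(1) Ft unfolding approximates_uniformly_def architecture_def by blast
    have v1: "v \<in> H1 \<Omega>" using v XY(2) by blast
    have "H1_norm \<Omega> w \<le> Q"
      using H1_norm_le_diff[OF \<Omega> w1 v1] w(2) \<delta>t(2) hyp3(2)[OF v] Q by linarith
    with w w1 H1_diff[OF \<Omega> w1 v1] show ?thesis by (auto simp: Xt_def H1_ball_def)
  qed
  \<comment> \<open>Holds for all admissible bounds at once: the network sets \<open>Xs\<close> and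
    \<open>Xt\<close> were fixed before \<open>Ms\<close>, \<open>Bs\<close>, \<open>Mt\<close> and
    \<open>Bt\<close> are given.\<close>
  have main: "xi_app \<Omega> (K \<inter> Y) uStar Xs Xt (C\<^sub>b * Ms + f_norm + 1 / \<gamma> * (Ms + Mt))
      (w_o2 * (r + Mt + 2 * p)) (2 * w_b2 * (h_norm + Bt))
      (C\<^sub>b * (Ms + Mt) + C1 + 1 / \<gamma> * (U + Mt))
      (w_o1 * (Ms + U + 2 * p)) (2 * w_b1 * (h_norm + Bs)) \<le> ereal \<epsilon>"
    if M: "Ms \<in> {0<..R}" "Bs \<in> {0<..R}" "Mt \<in> {0<..R}" "Bt \<in> {0<..R}" for Ms Bs Mt Bt
  proof -
    have abs: "\<bar>c * x\<bar> \<le> c * y" if "0 \<le> c" "0 \<le> x" "x \<le> y" for c x y :: real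
      using that by (simp add: abs_mult mult_left_mono)
    have \<gamma>': "0 \<le> 1 / \<gamma>" and Cb: "0 \<le> C\<^sub>b" using \<gamma> C_pos by simp_all
    have "\<bar>C\<^sub>b * Ms\<bar> \<le> C\<^sub>b * R"
      by (rule abs[OF Cb]) (use M in auto)
    moreover have "\<bar>1 / \<gamma> * (Ms + Mt)\<bar> \<le> 1 / \<gamma> * (R + R)"
      by (rule abs[OF \<gamma>']) (use M in auto)
    ultimately have b1: "\<bar>C\<^sub>b * Ms + f_norm + 1 / \<gamma> * (Ms + Mt)\<bar> \<le> D1" unfolding D1_def by linarith
    have b2: "\<bar>w_o2 * (r + Mt + 2 * p)\<bar> \<le> D2"
      unfolding D2_def using M nn r(1) by (intro abs[OF weights(4)]) auto
    have b3: "\<bar>2 * w_b2 * (h_norm + Bt)\<bar> \<le> D3"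
      unfolding D3_def using M nn weights(2) by (intro abs) auto
    have "\<bar>C\<^sub>b * (Ms + Mt)\<bar> \<le> C\<^sub>b * (R + R)"
      by (rule abs[OF Cb]) (use M in auto)
    moreover have "\<bar>1 / \<gamma> * (U + Mt)\<bar> \<le> 1 / \<gamma> * (U + R)"
      by (rule abs[OF \<gamma>']) (use M nn in auto)
    ultimately have b4: "\<bar>C\<^sub>b * (Ms + Mt) + C1 + 1 / \<gamma> * (U + Mt)\<bar> \<le> D4" unfolding D4_def by linarith
    have b5: "\<bar>w_o1 * (Ms + U + 2 * p)\<bar> \<le> D5"
      unfolding D5_def using M nn by (intro abs[OF weights(3)]) auto
    have b6: "\<bar>2 * w_b1 * (h_norm + Bs)\<bar> \<le> D6"
      unfolding D6_def using M nn weights(1) by (intro abs) auto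
    show ?thesis
    proof (rule xi_app_le[OF _ N_Xs])
      fix v assume "v \<in> K \<inter> Y"
      then obtain w where w: "w \<in> Xt" "w - v \<in> H1 \<Omega>" "H1_norm \<Omega> (w - v) \<le> \<delta>t" using Xt by blast
      from order_trans[OF weighted_norm_le[OF trace_const[OF w(2)] b1 b2 b3 w(3)] \<delta>t(3)] w(1)
      show "\<exists>w\<in>Xt. weighted_norm \<Omega> (C\<^sub>b * Ms + f_norm + 1 / \<gamma> * (Ms + Mt))
          (w_o2 * (r + Mt + 2 * p)) (2 * w_b2 * (h_norm + Bt)) (w - v) \<le> \<epsilon> / 2"
        by (rule bexI)
    next
      show "weighted_norm \<Omega> (C\<^sub>b * (Ms + Mt) + C1 + 1 / \<gamma> * (U + Mt))
          (w_o1 * (Ms + U + 2 * p)) (2 * w_b1 * (h_norm + Bs)) (N - uStar) \<le> \<epsilon> / 2"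
        by (rule order_trans[OF weighted_norm_le[OF
              trace_const[OF H1_diff[OF \<Omega> N(2) uStar_H1]] b4 b5 b6 N(3)] \<delta>s(3)])
    qed
  qed
  show "\<exists>Fs Ft \<sigma>s \<sigma>t ds ws dt wt.
    approximates_H2 \<Omega> Fs \<sigma>s \<and> approximates_uniformly \<Omega> Y Ft \<sigma>t \<and>
    (let Xs = Fs ds ws \<sigma>s \<inter> H1_ball \<Omega> P;
         Xt = Ft dt wt \<sigma>t \<inter> H1_ball \<Omega> Q;
         Rstar = Max {P, Q, C\<^sub>T * P, C\<^sub>T * Q}
     in \<forall>Ms\<in>{0<..Rstar}. \<forall>Bs\<in>{0<..Rstar}. \<forall>Mt\<in>{0<..Rstar}. \<forall>Bt\<in>{0<..Rstar}.
          (\<forall>u\<in>Xs. H1_norm \<Omega> u \<le> Ms \<and> bdry_norm \<Omega> u \<le> Bs) \<longrightarrow>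
          (\<forall>v\<in>Xt. H1_norm \<Omega> v \<le> Mt \<and> bdry_norm \<Omega> v \<le> Bt) \<longrightarrow>
          (let f_norm = dual_norm \<Omega> (L2_functional \<Omega> f);
               h_norm = L2_norm (surface_measure \<Omega>) h;
               C1 = dual_norm \<Omega> (operator_A \<Omega> b k uStar - L2_functional \<Omega> f);
               K1 = C\<^sub>b * Ms + f_norm + 1 / \<gamma> * (Ms + Mt);
               K2 = w_o2 * (r + Mt + 2 * dom_norm \<Omega> \<psi>);
               K3 = 2 * w_b2 * (h_norm + Bt);
               K4 = C\<^sub>b * (Ms + Mt) + C1 + 1 / \<gamma> * (H1_norm \<Omega> uStar + Mt);
               K5 = w_o1 * (Ms + H1_norm \<Omega> uStar + 2 * dom_norm \<Omega> \<psi>);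
               K6 = 2 * w_b1 * (h_norm + Bs)
           in xi_app \<Omega> (K \<inter> Y) uStar Xs Xt K1 K2 K3 K4 K5 K6 \<le> ereal \<epsilon>))"
    unfolding Let_def
    using main[unfolded Xs_def Xt_def R_def f_norm_def h_norm_def C1_def p_def U_def]
    by (intro exI[of _ Fs] exI[of _ Ft] exI[of _ \<sigma>s] exI[of _ \<sigma>t] exI[of _ ds] exI[of _ ws]
        exI[of _ dt] exI[of _ wt] conjI Fs Ft ballI impI)
qed

end
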